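(* Let $N\in\mathbb N^*$, $\gamma>0$ and $\tau=\tau_1+i\tau_2\in\mathbb C$ with $\gamma^2\tau_2=\pi N$. Then, for all $\kappa\in\mathbb C$ and all integers $0\le k\le N-1$, the function $$u(t,z)=\kappa\,e^{-i\lambda_0|\kappa|^2t}\,\Phi_k(z)$$ is a stationary solution of $i\partial_tu=\Pi(|u|^2u)$, where $$\lambda_0=\frac{\int_{K_{\tau,\gamma}}|\Phi_k(z)|^4dL(z)}{\int_{K_{\tau,\gamma}}|\Phi_k(z)|^2dL(z)}=\frac\gamma{\sqrt{2\pi}}\,e^{\pi^2/(2\gamma^2)}\sum_{j,\ell\in\mathbb Z}\exp\Big(-\gamma^2\Big|j\frac\tau N-\ell\Big|^2\Big).$$ In particular: - If $N=1$ and $\tau=i\pi/\gamma^2$ (rectangular lattice), then $\lambda_0=\frac1{\sqrt2}e^{\pi^2/(2\gamma^2)}\Big(\sum_{q\in\mathbb Z}e^{-\pi^2q^2/\gamma^2}\Big)^2.$ - If $N=1$, $\tau=e^{2i\pi/3}$ and $\gamma=\sqrt{2\pi}/3^{1/4}$ (hexagonal lattice), then $\lambda_0=\frac1{\sqrt2}e^{\pi^2/(2\gamma^2)}\big(I^2+2IJ-J^2\big)$ with $I=\sum_{j\in\mathbb Z}e^{-\pi^2(2j)^2/\gamma^2}$ and $J=\sum_{j\in\mathbb Z}e^{-\pi^2(2j+1)^2/\gamma^2}$.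
   Context: $L$ is Lebesgue measure on $\mathbb C$. For a function $u$ on $\mathbb C$ of at most polynomial growth, $[\Pi u](z)=\frac1\pi e^{-|z|^2/2}\int_{\mathbb C}e^{\overline w z-|w|^2/2}u(w)\,dL(w)$. For $\alpha\in\mathbb C$, $R_\alpha u(z)=e^{(\alpha\overline z-\overline\alpha z)/2}u(z+\alpha)$. $K_{\tau,\gamma}=\{\gamma(r_1+r_2\tau):r_1,r_2\in[0,1]\}$. For $\mathrm{Im}\,\tau>0$, $\Theta_\tau(z)=-i\sum_{n\in\mathbb Z}(-1)^n\exp\big(i\pi\tau(n+\tfrac12)^2+i(2n+1)\pi z\big)$. Set $$\Phi_0(z)=\exp\Big(\tfrac12z^2-\tfrac{i\pi}\gamma z-\tfrac12|z|^2\Big)\Theta_{\tau/N}\Big(\frac{z-z_0}\gamma\Big),\quad z_0=\frac\gamma2\Big(\frac\tau N-1\Big),\qquad \Phi_k=R_{k\gamma/N}\Phi_0,\ 0\le k\le N-1.$$ *)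

theory Defs
  imports "HOL-Analysis.Analysis"
begin

definition poly_growth :: "(complex \<Rightarrow> complex) \<Rightarrow> bool" where
  "poly_growth u \<longleftrightarrow> u \<in> borel_measurable lebesgue \<and>
     (\<exists>C m. \<forall>z. cmod (u z) \<le> C * (1 + cmod z) ^ m)"

text \<open>The integral converges absolutely for every function satisfying \<^const>\<open>poly_growth\<close>;
  outside this class the value of the operator is not meaningful.\<close>

definition LLL_proj :: "(complex \<Rightarrow> complex) \<Rightarrow> complex \<Rightarrow> complex" where
  "LLL_proj u z = 1 / of_real pi * exp (- of_real ((cmod z)\<^sup>2) / 2) *
     (LINT w|lebesgue. exp (cnj w * z - of_real ((cmod w)\<^sup>2) / 2) * u w)"

text \<open>Solutions of \<open>\<i> \<partial>\<^sub>t u = \<Pi> (\<bar>u\<bar>\<^sup>2 u)\<close> for all real times. The growth condition puts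
  the nonlinearity in the domain of the projector.\<close>

definition LLL_solution :: "(real \<Rightarrow> complex \<Rightarrow> complex) \<Rightarrow> bool" where
  "LLL_solution u \<longleftrightarrow> (\<forall>t. poly_growth (u t)) \<and>
     (\<forall>t z. \<exists>D. ((\<lambda>s. u s z) has_vector_derivative D) (at t) \<and>
        \<i> * D = LLL_proj (\<lambda>w. of_real ((cmod (u t w))\<^sup>2) * u t w) z)"

definition stationary_solution :: "(real \<Rightarrow> complex \<Rightarrow> complex) \<Rightarrow> bool" where
  "stationary_solution u \<longleftrightarrow> LLL_solution u \<and>
     (\<exists>(\<omega>::real) v. \<forall>t z. u t z = exp (- \<i> * of_real (\<omega> * t)) * v z)"

definition magnetic_translation :: "complex \<Rightarrow> (complex \<Rightarrow> complex) \<Rightarrow> complex \<Rightarrow> complex" where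
  "magnetic_translation \<alpha> u z = exp ((\<alpha> * cnj z - cnj \<alpha> * z) / 2) * u (z + \<alpha>)"

definition fundamental_cell :: "complex \<Rightarrow> real \<Rightarrow> complex set" where
  "fundamental_cell \<tau> \<gamma> =
     {of_real \<gamma> * (of_real r\<^sub>1 + of_real r\<^sub>2 * \<tau>) | r\<^sub>1 r\<^sub>2. r\<^sub>1 \<in> {0..1::real} \<and> r\<^sub>2 \<in> {0..1::real}}"

definition Theta :: "complex \<Rightarrow> complex \<Rightarrow> complex" where
  "Theta \<tau> z = - \<i> * (\<Sum>\<^sub>\<infinity>n::int. (-1) powi n *
     exp (\<i> * of_real pi * \<tau> * (of_int n + 1/2)\<^sup>2 + \<i> * of_int (2 * n + 1) * of_real pi * z))"

definition Phi_0 :: "nat \<Rightarrow> real \<Rightarrow> complex \<Rightarrow> complex \<Rightarrow> complex" where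
  "Phi_0 N \<gamma> \<tau> z =
     (let z\<^sub>0 = of_real \<gamma> / 2 * (\<tau> / of_nat N - 1)
      in exp (z\<^sup>2 / 2 - \<i> * of_real pi / of_real \<gamma> * z - of_real ((cmod z)\<^sup>2) / 2) *
         Theta (\<tau> / of_nat N) ((z - z\<^sub>0) / of_real \<gamma>))"

definition Phi :: "nat \<Rightarrow> real \<Rightarrow> complex \<Rightarrow> nat \<Rightarrow> complex \<Rightarrow> complex" where
  "Phi N \<gamma> \<tau> k = magnetic_translation (of_real (real k * \<gamma> / real N)) (Phi_0 N \<gamma> \<tau>)"

end

theory Submission
  imports Defs "HOL-Probability.Characteristic_Functions"
begin

text \<open>
  Put \<open>h = \<pi> / \<gamma>\<close> and \<open>\<sigma> = \<tau> / N\<close>, so that \<open>Im \<sigma> = h / \<gamma>\<close>. Expanding the theta series shows that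
  \<open>\<Phi>\<^sub>k\<close> is \<open>exp (-\<i>\<pi>\<sigma>/4)\<close> times \<open>u = \<Sum>\<^sub>n a\<^sub>n e\<^sub>n\<close>, where \<open>\<bar>a\<^sub>n\<bar> = 1\<close>, \<open>a\<^sub>n\<close> has a phase
  quadratic in \<open>n\<close>, and \<open>e\<^sub>n\<close> is the plane wave \<open>exp (\<i>xy + 2\<i>hnx)\<close> times the Gaussian
  \<open>exp (-(y + hn)\<^sup>2)\<close>. The projector maps \<open>e\<^sub>i \<cdot> cnj e\<^sub>j \<cdot> e\<^sub>k\<close> to a multiple of
  \<open>e\<^sub>m\<close> with \<open>m = i - j + k\<close>. With \<open>i = m + p\<close>, \<open>k = m + q\<close>, \<open>j = m + p + q\<close> the quadratic phases combine
  to \<open>a\<^sub>m exp (-2\<pi>\<i> (Re \<sigma>) p q)\<close> and the Gaussian integral is \<open>exp (-h\<^sup>2 (p\<^sup>2 + q\<^sup>2)) / sqrt 2\<close>,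
  independently of \<open>m\<close>; hence \<open>\<Pi> (\<bar>u\<bar>\<^sup>2 u)\<close> is a multiple of \<open>u\<close>. Integrating over the cell in
  \<open>x\<close> first keeps only the resonant terms of \<open>\<bar>u\<bar>\<^sup>2\<close> and \<open>\<bar>u\<bar>\<^sup>4\<close>, and the remaining integrals over \<open>y\<close>
  unfold to the same Gaussian integrals over the line. Poisson summation in \<open>q\<close> gives the lattice sum.
\<close>

section \<open>Integration and summation\<close>

text \<open>Every exchange of sum and integral rests instead on one estimate: the sum of exp (- (y +
  h n)^2) over all n is at most \<open>gauss_bound h\<close>, whatever \<open>y\<close> is. A power
  of this constant times the kernel, or times the indicator of the cell, is an integrable majorant.

  The eigenvalue of the projector and the quotient of the cell integrals agree for a concrete
  reason. In |u|^4 four Gaussians are visible, in |u|^2 u only three; integrating over the real part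
  against the kernel creates the fourth. Neither computation uses quasi-periodicity of
  \<open>Phi\<close>, only its series.

  The shift k enters through a phase linear in n, which cancels in i - j + k = m, so all the
  \<open>Phi\<close> share one eigenvalue. The factor exp (pi^2 / (2 \<gamma>^2)) in the result is
  the squared modulus of exp (-\<i> pi \<sigma> / 4), which splits off from the theta
  series.\<close>

lemma sums_reindex_from_nat_into:
  fixes f :: "'i::countable \<Rightarrow> 'b::{banach}"
  assumes "infinite (UNIV :: 'i set)" "(f has_sum S) UNIV"
  shows "(\<lambda>n. f (from_nat_into UNIV n)) sums S"
  using has_sum_reindex_bij_betw[OF bij_betw_from_nat_into[of "UNIV :: 'i set"], of f S] assms
  by (auto intro: has_sum_imp_sums)

lemma borel_measurable_infsum:
  fixes f :: "'i::countable \<Rightarrow> 'a \<Rightarrow> 'b::{banach,second_countable_topology}"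
  assumes inf: "infinite (UNIV :: 'i set)"
    and [measurable]: "\<And>i. f i \<in> borel_measurable M"
    and s: "\<And>x. x \<in> space M \<Longrightarrow> (\<lambda>i. f i x) summable_on UNIV"
  shows "(\<lambda>x. \<Sum>\<^sub>\<infinity>i. f i x) \<in> borel_measurable M"
proof -
  have "(\<Sum>\<^sub>\<infinity>i. f i x) = (\<Sum>n. f (from_nat_into UNIV n) x)" if "x \<in> space M" for x
    using sums_reindex_from_nat_into[OF inf has_sum_infsum[OF s[OF that]]] by (simp add: sums_unique)
  then show ?thesis
    by (simp cong: measurable_cong)
qed

text \<open>Termwise integration for unordered sums: \<open>g\<close> dominates the sum of all
  norms, hence every finite partial sum. An enumeration of the index type transfers the question to
  series over the naturals; \<open>inf\<close> makes \<open>from_nat_into\<close> a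
  bijection.\<close>

lemma has_sum_integral:
  fixes f :: "'i::countable \<Rightarrow> 'a \<Rightarrow> 'b::{banach,second_countable_topology}"
  assumes inf: "infinite (UNIV :: 'i set)"
    and [measurable]: "\<And>i. f i \<in> borel_measurable M"
    and g: "integrable M g"
    and s: "\<And>x. (\<lambda>i. norm (f i x)) summable_on UNIV"
    and le: "\<And>x. (\<Sum>\<^sub>\<infinity>i. norm (f i x)) \<le> g x"
  shows "((\<lambda>i. \<integral>x. f i x \<partial>M) has_sum (\<integral>x. (\<Sum>\<^sub>\<infinity>i. f i x) \<partial>M)) UNIV"
proof -
  let ?e = "from_nat_into (UNIV :: 'i set)"
  have bij: "bij_betw ?e UNIV UNIV"
    using bij_betw_from_nat_into[of "UNIV :: 'i set"] inf by simp
  have fin: "(\<Sum>i\<in>F. norm (f i x)) \<le> g x" if "finite F" for F x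
    using finite_sum_le_infsum[OF s that, of x] le[of x] by simp
  have int: "integrable M (f i)" for i
    by (rule Bochner_Integration.integrable_bound[OF g])
       (use fin[of "{i}"] in \<open>auto intro!: AE_I2 order.trans[OF _ abs_ge_self]\<close>)
  have S: "(\<lambda>n. f (?e n) x) sums (\<Sum>\<^sub>\<infinity>i. f i x)" for x
    by (rule sums_reindex_from_nat_into[OF inf has_sum_infsum[OF abs_summable_summable[OF s]]])
  have N: "summable (\<lambda>n. norm (f (?e n) x))" for x
    using sums_reindex_from_nat_into[OF inf has_sum_infsum[OF s]] by (simp add: sums_iff)
  have sum_int: "summable (\<lambda>n. \<integral>x. norm (f (?e n) x) \<partial>M)"
  proof (rule summableI_nonneg_bounded)
    fix n
    have "(\<Sum>k<n. \<integral>x. norm (f (?e k) x) \<partial>M) = (\<integral>x. (\<Sum>k<n. norm (f (?e k) x)) \<partial>M)"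
      by (rule Bochner_Integration.integral_sum[symmetric]) (use int in auto)
    also have "\<dots> \<le> (\<integral>x. g x \<partial>M)"
    proof (rule integral_mono)
      show "integrable M (\<lambda>x. \<Sum>k<n. norm (f (?e k) x))"
        using int by auto
      have "inj_on ?e {..<n}"
        using bij by (auto simp: bij_betw_def inj_on_def)
      then show "(\<Sum>k<n. norm (f (?e k) x)) \<le> g x" for x
        using fin[of "?e ` {..<n}" x] by (simp add: sum.reindex)
    qed (use g in auto)
    finally show "(\<Sum>k<n. \<integral>x. norm (f (?e k) x) \<partial>M) \<le> (\<integral>x. g x \<partial>M)" .
  qed simp
  have "(\<lambda>n. \<integral>x. f (?e n) x \<partial>M) sums (\<integral>x. (\<Sum>n. f (?e n) x) \<partial>M)"
    by (rule sums_integral) (use int N sum_int in auto)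
  \<comment> \<open>Absolute convergence upgrades the ordered series of integrals to an unordered
    sum.\<close>
  moreover have "summable (\<lambda>n. norm (\<integral>x. f (?e n) x \<partial>M))"
    by (rule summable_comparison_test'[OF sum_int, of 0]) simp
  ultimately have "((\<lambda>n. \<integral>x. f (?e n) x \<partial>M) has_sum (\<integral>x. (\<Sum>n. f (?e n) x) \<partial>M)) UNIV"
    by (rule norm_summable_imp_has_sum[rotated])
  then show ?thesis
    using S by (simp add: has_sum_reindex_bij_betw[OF bij, of "\<lambda>i. \<integral>x. f i x \<partial>M"] sums_unique[symmetric, OF S])
qed

text \<open>The second conclusion is the premise for the next stage: products of three and four
  series arise by iterating the lemma.\<close>

lemma has_sum_times:
  fixes f :: "'i \<Rightarrow> 'c::{real_normed_field,banach}" and g :: "'j \<Rightarrow> 'c"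
  assumes f: "(\<lambda>x. norm (f x)) summable_on A" and g: "(\<lambda>x. norm (g x)) summable_on B"
  shows "((\<lambda>(x,y). f x * g y) has_sum infsum f A * infsum g B) (A \<times> B)"
    and "(\<lambda>p. norm ((\<lambda>(x,y). f x * g y) p)) summable_on A \<times> B"
proof -
  show *: "(\<lambda>p. norm ((\<lambda>(x,y). f x * g y) p)) summable_on A \<times> B"
  proof (rule summable_on_SigmaI)
    fix x assume "x \<in> A"
    show "((\<lambda>y. norm ((\<lambda>(x,y). f x * g y) (x,y))) has_sum norm (f x) * infsum (\<lambda>x. norm (g x)) B) B"
      using has_sum_cmult_right[OF has_sum_infsum[OF g], of "norm (f x)"] by (simp add: norm_mult)
  qed (use f in \<open>auto intro: summable_on_cmult_left\<close>)
  show "((\<lambda>(x,y). f x * g y) has_sum infsum f A * infsum g B) (A \<times> B)"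
  proof (rule has_sum_SigmaI)
    fix x assume "x \<in> A"
    show "((\<lambda>y. (\<lambda>(x,y). f x * g y) (x,y)) has_sum f x * infsum g B) B"
      using has_sum_cmult_right[OF has_sum_infsum[OF abs_summable_summable[OF g]], of "f x"] by simp
  next
    show "((\<lambda>x. f x * infsum g B) has_sum infsum f A * infsum g B) A"
      by (intro has_sum_cmult_left has_sum_infsum abs_summable_summable[OF f])
  qed (rule abs_summable_summable[OF *])
qed

text \<open>A half-open window of length \<open>h * real N\<close> meets every coset of the lattice
  of step \<open>h\<close> in exactly \<open>N\<close> points; a closed one can meet it in
  \<open>N + 1\<close>.\<close>

lemma ints_in_window:
  fixes h y :: real
  assumes "h > 0"
  shows "{m::int. y - h * m \<in> {0..<h * real N}} = {\<lfloor>y / h\<rfloor> - int N <.. \<lfloor>y / h\<rfloor>}"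
proof -
  have 1: "0 \<le> y - h * m \<longleftrightarrow> m \<le> y / h" for m :: int
    using assms by (simp add: pos_le_divide_eq mult.commute)
  have 2: "y - h * m < h * real N \<longleftrightarrow> y / h < of_int (m + int N)" for m :: int
    using assms by (simp add: divide_less_eq algebra_simps)
  show ?thesis
    unfolding set_eq_iff mem_Collect_eq atLeastLessThan_iff greaterThanAtMost_iff 1 2
    using le_floor_iff floor_less_iff by (metis add.commute add_diff_cancel_right' diff_less_eq)
qed

text \<open>Unfolding with overlaps: the window has length \<open>h * real N\<close> but moves in
  steps of \<open>h\<close>, so its translates cover the line \<open>N\<close> times. The factor
  \<open>N\<close> appears in both cell integrals and cancels in their quotient.\<close>

lemma has_sum_periodization:
  fixes f :: "real \<Rightarrow> complex"
  assumes f: "integrable lborel f" and h: "h > 0"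
  shows "((\<lambda>m::int. \<integral>y. indicator {0..h * real N} y *\<^sub>R f (y + h * m) \<partial>lborel)
           has_sum of_nat N * integral\<^sup>L lborel f) UNIV"
proof -
  have [measurable]: "f \<in> borel_measurable borel" using f by auto
  let ?F = "\<lambda>(m::int) y. indicator {0..<h * real N} (y - h * m) *\<^sub>R f y"
  have shift: "(\<integral>y. indicator {0..h * real N} y *\<^sub>R f (y + h * m) \<partial>lborel) = integral\<^sup>L lborel (?F m)" for m :: int
  proof -
    \<comment> \<open>The window is closed because the cell is; dropping one endpoint does not
      change the integral and makes the count of translates exact.\<close>
    have "(\<integral>y. indicator {0..h * real N} y *\<^sub>R f (y + h * m) \<partial>lborel)
        = (\<integral>y. indicator {0..<h * real N} y *\<^sub>R f (y + h * m) \<partial>lborel)"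
      by (rule integral_cong_AE)
         (auto intro!: eventually_mono[OF AE_lborel_singleton[of "h * real N"]] simp: indicator_def)
    also have "\<dots> = integral\<^sup>L lborel (?F m)"
      by (subst lborel_integral_real_affine[where c = 1 and t = "h * m"]) (auto simp: add.commute)
    finally show ?thesis .
  qed
  define A where "A y = {\<lfloor>y / h\<rfloor> - int N <.. \<lfloor>y / h\<rfloor>}" for y
  have A: "indicator {0..<h * real N} (y - h * m) = (indicator (A y) m :: real)" for y and m :: int
  proof -
    have "y - h * m \<in> {0..<h * real N} \<longleftrightarrow> m \<in> A y"
      using ints_in_window[OF h, of y N] unfolding A_def by blast
    then show ?thesis by (simp only: indicator_def)
  qed
  have HS: "((\<lambda>m. indicator (A y) m *\<^sub>R v) has_sum of_nat N *\<^sub>R v) UNIV"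
    for v :: "'z::{banach}" and y
  proof -
    have "((\<lambda>m. indicator (A y) m *\<^sub>R v) has_sum (\<Sum>m\<in>A y. v)) UNIV"
      by (rule has_sum_finite_neutralI[of "A y"]) (auto simp: A_def)
    then show ?thesis
      by (simp add: A_def sum_constant_scaleR del: sum_constant)
  qed
  have "((\<lambda>m. integral\<^sup>L lborel (?F m)) has_sum (\<integral>y. (\<Sum>\<^sub>\<infinity>m. ?F m y) \<partial>lborel)) UNIV"
  proof (rule has_sum_integral[where g = "\<lambda>y. real N * norm (f y)"])
    show "(\<lambda>m. norm (?F m y)) summable_on UNIV" for y
      using HS[of y "norm (f y)"] by (auto simp: A summable_on_def)
    show "(\<Sum>\<^sub>\<infinity>m. norm (?F m y)) \<le> real N * norm (f y)" for y
      using HS[of y "norm (f y)"] by (auto simp: A dest!: infsumI)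
  qed (use f in \<open>auto simp: infinite_UNIV_int\<close>)
  moreover have "(\<Sum>\<^sub>\<infinity>m. ?F m y) = of_nat N * f y" for y
    using HS[of y "f y"] by (auto simp: A scaleR_conv_of_real dest!: infsumI)
  ultimately show ?thesis
    using f by (simp add: shift)
qed

text \<open>No contour shift is made: the real part of \<open>\<beta>\<close> is absorbed by
  completing the square, and its imaginary part becomes the frequency in the characteristic function
  of the standard normal law.\<close>

lemma has_bochner_integral_gaussian:
  fixes \<beta> :: complex and a :: real
  assumes a: "a > 0"
  shows "has_bochner_integral lborel (\<lambda>y::real. exp (- of_real (a * y\<^sup>2) + \<beta> * of_real y))
           (of_real (sqrt (pi / a)) * exp (\<beta>\<^sup>2 / of_real (4 * a)))"
proof -
  define r s where "r = Re \<beta>" and "s = Im \<beta>"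
  define c where "c = sqrt (2 * a)"
  have c: "c > 0" "c\<^sup>2 = 2 * a" using a by (auto simp: c_def)
  \<comment> \<open>The substitution t + c x turns the standard density into exp (- a x^2 + r x) up
    to a constant, and T c = s restores the oscillation.\<close>
  define t T where "t = - r / c" and "T = s / c"
  let ?f = "\<lambda>x::real. of_real (exp (- x\<^sup>2 / 2)) * iexp (T * x)"
  have int: "integrable lborel (\<lambda>x. normal_density 0 1 x *\<^sub>R iexp (T * x))"
    by (rule Bochner_Integration.integrable_bound[of _ "normal_density 0 1"])
       (auto intro!: AE_I2)
  have "char std_normal_distribution T = (\<integral>x. normal_density 0 1 x *\<^sub>R iexp (T * x) \<partial>lborel)"
    unfolding char_def by (subst integral_density) auto
  then have "has_bochner_integral lborel (\<lambda>x. normal_density 0 1 x *\<^sub>R iexp (T * x)) (of_real (exp (- (T\<^sup>2) / 2)))"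
    using int by (simp add: has_bochner_integral_iff char_std_normal_distribution)
  from has_bochner_integral_mult_right[OF this, of "of_real (sqrt (2 * pi))"]
  have "has_bochner_integral lborel ?f (of_real (sqrt (2 * pi)) * of_real (exp (- (T\<^sup>2) / 2)))"
    by (simp add: std_normal_density_def scaleR_conv_of_real)
  from iffD1[OF lborel_has_bochner_integral_real_affine_iff[where c = c and t = t, OF less_imp_neq[OF c(1), symmetric]] this]
  have "has_bochner_integral lborel (\<lambda>x. ?f (t + c * x)) ((of_real (sqrt (2 * pi)) * of_real (exp (- (T\<^sup>2) / 2))) /\<^sub>R \<bar>c\<bar>)" .
  from has_bochner_integral_mult_right[OF this, of "exp (of_real (r\<^sup>2 / (4 * a)) + \<i> * of_real (s * r / (2 * a)))"]
  have *: "has_bochner_integral lborel (\<lambda>x. exp (of_real (r\<^sup>2 / (4 * a)) + \<i> * of_real (s * r / (2 * a))) * ?f (t + c * x))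
      (exp (of_real (r\<^sup>2 / (4 * a)) + \<i> * of_real (s * r / (2 * a))) *
        ((of_real (sqrt (2 * pi)) * of_real (exp (- (T\<^sup>2) / 2))) /\<^sub>R \<bar>c\<bar>))" .
  have aux: "c * c = 2 * a" using c(2) by (simp add: power2_eq_square)
  have t2: "t\<^sup>2 = r\<^sup>2 / (2 * a)" and T2: "T\<^sup>2 = s\<^sup>2 / (2 * a)" and tc: "t * c = - r" and Tc: "T * c = s"
    and Tt: "T * t = - (s * r / (2 * a))"
    using c aux by (auto simp: t_def T_def power_divide)
  have \<beta>: "\<beta> = of_real r + \<i> * of_real s"
    by (simp add: r_def s_def complex_eq_iff)
  have "exp (of_real (r\<^sup>2 / (4 * a)) + \<i> * of_real (s * r / (2 * a))) * ?f (t + c * x)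
      = exp (- of_real (a * x\<^sup>2) + \<beta> * of_real x)" for x
  proof -
    have 1: "- (t + c * x)\<^sup>2 / 2 = - (r\<^sup>2 / (4 * a)) + r * x - a * x\<^sup>2"
    proof -
      have "(t + c * x)\<^sup>2 = t\<^sup>2 + 2 * (t * c) * x + c\<^sup>2 * x\<^sup>2"
        by (simp add: power2_eq_square algebra_simps)
      then show ?thesis unfolding t2 tc c(2) by (simp add: field_simps)
    qed
    have 2: "T * (t + c * x) = - (s * r / (2 * a)) + s * x"
      using Tt Tc by (simp add: algebra_simps)
    show ?thesis
      unfolding 1 2 \<beta> by (simp add: exp_of_real[symmetric] mult_exp_exp algebra_simps)
  qed
  moreover have "exp (of_real (r\<^sup>2 / (4 * a)) + \<i> * of_real (s * r / (2 * a))) *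
        ((of_real (sqrt (2 * pi)) * of_real (exp (- (T\<^sup>2) / 2))) /\<^sub>R \<bar>c\<bar>)
      = of_real (sqrt (pi / a)) * exp (\<beta>\<^sup>2 / of_real (4 * a))"
  proof -
    have 1: "\<beta>\<^sup>2 / of_real (4 * a) = of_real (r\<^sup>2 / (4 * a)) + \<i> * of_real (s * r / (2 * a)) + of_real (- (T\<^sup>2) / 2)"
      unfolding \<beta> T2 using a by (simp add: power2_eq_square field_simps)
    have 2: "sqrt (pi / a) = sqrt (2 * pi) / \<bar>c\<bar>"
      using c by (simp add: c_def real_sqrt_divide real_sqrt_mult)
    show ?thesis
      unfolding 1 2 exp_add exp_of_real[symmetric] by (simp add: scaleR_conv_of_real field_simps)
  qed
  ultimately show ?thesis using * by simp
qed

section \<open>Lebesgue measure on the plane as a product measure\<close>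

lemma lborel_complex_eq_distr:
  "(lborel :: complex measure) = distr (lborel \<Otimes>\<^sub>M lborel) borel (\<lambda>(x, y). Complex x y)"
proof (rule lborel_eqI)
  have [measurable]: "(\<lambda>(x, y). Complex x y) \<in> lborel \<Otimes>\<^sub>M lborel \<rightarrow>\<^sub>M borel"
    unfolding Complex_eq by measurable
  fix l u :: complex assume le: "\<And>b. b \<in> Basis \<Longrightarrow> l \<bullet> b \<le> u \<bullet> b"
  have le': "Re l \<le> Re u" "Im l \<le> Im u"
    using le[of 1] le[of \<i>] by (auto simp: Basis_complex_def inner_complex_def)
  have "(\<lambda>(x, y). Complex x y) -` box l u \<inter> space (lborel \<Otimes>\<^sub>M lborel) = {Re l<..<Re u} \<times> {Im l<..<Im u}"
    by (auto simp: box_def Basis_complex_def inner_complex_def space_pair_measure)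
  then have "emeasure (distr (lborel \<Otimes>\<^sub>M lborel) borel (\<lambda>(x, y). Complex x y)) (box l u)
      = emeasure (lborel \<Otimes>\<^sub>M lborel) ({Re l<..<Re u} \<times> {Im l<..<Im u})"
    by (subst emeasure_distr) auto
  also have "\<dots> = ennreal (Re u - Re l) * ennreal (Im u - Im l)"
    using le' by (subst lborel.emeasure_pair_measure_Times) auto
  finally show "emeasure (distr (lborel \<Otimes>\<^sub>M lborel) borel (\<lambda>(x, y). Complex x y)) (box l u)
      = (\<Prod>b\<in>Basis. (u - l) \<bullet> b)"
    using le' by (simp add: Basis_complex_def inner_complex_def ennreal_mult')
qed simp

lemma integral_lborel_complex:
  fixes f :: "complex \<Rightarrow> 'b::{banach,second_countable_topology}"
  assumes f: "integrable lborel f"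
  shows "integral\<^sup>L lborel f = (\<integral>y. (\<integral>x. f (Complex x y) \<partial>lborel) \<partial>lborel)"
proof -
  have [measurable]: "(\<lambda>(x, y). Complex x y) \<in> lborel \<Otimes>\<^sub>M lborel \<rightarrow>\<^sub>M borel"
    unfolding Complex_eq by measurable
  have [measurable]: "f \<in> borel_measurable borel" using f by auto
  have "integrable (lborel \<Otimes>\<^sub>M lborel) (\<lambda>p. f ((\<lambda>(x, y). Complex x y) p))"
    using f by (subst (asm) lborel_complex_eq_distr) (simp add: integrable_distr_eq)
  then have "(\<integral>y. (\<integral>x. f (Complex x y) \<partial>lborel) \<partial>lborel) = (\<integral>p. f ((\<lambda>(x, y). Complex x y) p) \<partial>(lborel \<Otimes>\<^sub>M lborel))"
    using lborel_pair.integral_snd[of "\<lambda>x y. f (Complex x y)"] by (simp add: case_prod_unfold)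
  also have "\<dots> = integral\<^sup>L lborel f"
    by (subst lborel_complex_eq_distr) (simp add: integral_distr)
  finally show ?thesis ..
qed

lemma integrable_lborel_complex_mult:
  fixes f g :: "real \<Rightarrow> real"
  assumes f: "integrable lborel f" and g: "integrable lborel g"
  shows "integrable lborel (\<lambda>z. f (Re z) * g (Im z))"
proof -
  have [measurable]: "(\<lambda>(x, y). Complex x y) \<in> lborel \<Otimes>\<^sub>M lborel \<rightarrow>\<^sub>M borel"
    unfolding Complex_eq by measurable
  have [measurable]: "f \<in> borel_measurable borel" "g \<in> borel_measurable borel" using f g by auto
  have "integrable (lborel \<Otimes>\<^sub>M lborel) (\<lambda>p. f (fst p) * g (snd p))"
    by (rule lborel_pair.Fubini_integrable) (use f g in \<open>auto simp: abs_mult\<close>)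
  then show ?thesis
    by (subst lborel_complex_eq_distr) (simp add: integrable_distr_eq case_prod_unfold)
qed

section \<open>Gaussian sums and uniqueness of Fourier coefficients\<close>

lemma summable_on_gaussian_int:
  fixes c :: real
  assumes c: "c > 0"
  shows "(\<lambda>n::int. exp (- (c * (of_int n)\<^sup>2))) summable_on UNIV"
proof -
  have nat: "(\<lambda>n::nat. exp (- (c * (real n)\<^sup>2))) summable_on UNIV"
  proof (rule summable_nonneg_imp_summable_on)
    show "summable (\<lambda>n::nat. exp (- (c * (real n)\<^sup>2)))"
    proof (rule summable_comparison_test'[of "\<lambda>n. exp (- c) ^ n" 0])
      show "summable (\<lambda>n. exp (- c) ^ n)" using c by (simp add: summable_geometric)
      fix n :: nat
      have "real n \<le> (real n)\<^sup>2" by (cases n) (auto simp: power2_eq_square)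
      then have "exp (- (c * (real n)\<^sup>2)) \<le> exp (real n * (- c))"
        using c by (simp add: mult.commute[of _ c])
      then show "norm (exp (- (c * (real n)\<^sup>2))) \<le> exp (- c) ^ n"
        by (simp only: exp_of_nat_mult real_norm_def abs_exp_cancel)
    qed
  qed simp
  have "(\<lambda>n::int. exp (- (c * (of_int n)\<^sup>2))) summable_on range int"
    by (subst summable_on_reindex) (use nat in \<open>auto simp: o_def\<close>)
  moreover have "(\<lambda>n::int. exp (- (c * (of_int n)\<^sup>2))) summable_on range (\<lambda>n. - int n)"
    by (subst summable_on_reindex) (use nat in \<open>auto simp: o_def inj_on_def\<close>)
  ultimately have "(\<lambda>n::int. exp (- (c * (of_int n)\<^sup>2))) summable_on (range int \<union> range (\<lambda>n. - int n))"
    by (rule summable_on_union)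
  also have "range int \<union> range (\<lambda>n. - int n) = UNIV"
  proof -
    have "x \<in> range int \<union> range (\<lambda>n. - int n)" for x
      by (cases x rule: int_cases2) auto
    then show ?thesis by blast
  qed
  finally show ?thesis .
qed

text \<open>The factor exp (h^2) pays for the remainder of \<open>y\<close> modulo \<open>h\<close>
  when \<open>power2_sum_ge\<close> separates it from the lattice point.\<close>

definition gauss_bound :: "real \<Rightarrow> real" where
  "gauss_bound h = exp (h\<^sup>2) * (\<Sum>\<^sub>\<infinity>n::int. exp (- (h\<^sup>2 / 2 * (of_int n)\<^sup>2)))"

lemma power2_sum_ge: "(a + r)\<^sup>2 \<ge> a\<^sup>2 / 2 - (r::real)\<^sup>2"
proof -
  have "0 \<le> (a + 2 * r)\<^sup>2 / 2" by simp
  also have "\<dots> = (a + r)\<^sup>2 - (a\<^sup>2 / 2 - r\<^sup>2)" by (simp add: power2_eq_square field_simps)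
  finally show ?thesis by simp
qed

text \<open>Reindexing by the floor of y / h replaces \<open>y\<close> by a remainder between 0 and
  \<open>h\<close>, which makes the bound uniform in \<open>y\<close>.\<close>

lemma gaussian_translates:
  fixes h y :: real
  assumes h: "h > 0"
  shows "(\<lambda>n::int. exp (- (y + h * n)\<^sup>2)) summable_on UNIV"
    and "(\<Sum>\<^sub>\<infinity>n::int. exp (- (y + h * n)\<^sup>2)) \<le> gauss_bound h"
proof -
  define k where "k = \<lfloor>y / h\<rfloor>"
  define r where "r = y - h * k"
  have "of_int k \<le> y / h" "y / h \<le> of_int k + 1"
    unfolding k_def by linarith+
  then have "of_int k * h \<le> y" "y \<le> (of_int k + 1) * h"
    using h by (simp_all only: pos_le_divide_eq pos_divide_le_eq)
  then have "0 \<le> r" "r \<le> h"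
    by (simp_all add: r_def algebra_simps)
  then have r2: "r\<^sup>2 \<le> h\<^sup>2" by (intro power_mono)
  let ?g = "\<lambda>n::int. exp (h\<^sup>2) * exp (- (h\<^sup>2 / 2 * (of_int (n + k))\<^sup>2))"
  have bij: "bij_betw (\<lambda>n. n + k) UNIV UNIV"
    by (rule bij_betw_byWitness[of _ "\<lambda>n. n - k"]) auto
  have "((\<lambda>n::int. exp (h\<^sup>2) * exp (- (h\<^sup>2 / 2 * (of_int n)\<^sup>2))) has_sum gauss_bound h) UNIV"
    unfolding gauss_bound_def by (intro has_sum_cmult_right has_sum_infsum summable_on_gaussian_int) (use h in auto)
  then have g: "(?g has_sum gauss_bound h) UNIV"
    by (subst has_sum_reindex_bij_betw[OF bij])
  have le: "exp (- (y + h * n)\<^sup>2) \<le> ?g n" for n :: int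
  proof -
    have "y + h * n = h * of_int (n + k) + r" by (simp add: r_def algebra_simps)
    then have "(y + h * n)\<^sup>2 \<ge> (h * of_int (n + k))\<^sup>2 / 2 - r\<^sup>2"
      using power2_sum_ge by metis
    then have "- (y + h * n)\<^sup>2 \<le> h\<^sup>2 + - (h\<^sup>2 / 2 * (of_int (n + k))\<^sup>2)"
      using r2 by (simp add: power_mult_distrib)
    then show ?thesis by (simp only: exp_add[symmetric] exp_le_cancel_iff)
  qed
  show *: "(\<lambda>n::int. exp (- (y + h * n)\<^sup>2)) summable_on UNIV"
    by (rule summable_on_comparison_test[of ?g]) (use g le in \<open>auto simp: summable_on_def\<close>)
  show "(\<Sum>\<^sub>\<infinity>n::int. exp (- (y + h * n)\<^sup>2)) \<le> gauss_bound h"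
    by (rule has_sum_mono[OF has_sum_infsum[OF *] g]) (use le in auto)
qed

lemma continuous_on_infsum:
  fixes f :: "'i \<Rightarrow> 'a::topological_space \<Rightarrow> 'b::banach"
  assumes "\<And>i. continuous_on S (f i)" "\<And>i x. x \<in> S \<Longrightarrow> norm (f i x) \<le> M i" "M summable_on UNIV"
  shows "continuous_on S (\<lambda>x. \<Sum>\<^sub>\<infinity>i. f i x)"
  by (rule uniform_limit_theorem[OF _ Weierstrass_m_test_general[of UNIV S f M]])
     (use assms in \<open>auto intro!: always_eventually continuous_on_sum\<close>)

text \<open>Each term reaches the value 1 somewhere on the line, so no summable majorant serves all
  \<open>y\<close> at once. On a bounded open interval there is one, and such intervals exhaust the
  line.\<close>

lemma continuous_on_gaussian_translates:
  fixes h :: real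
  assumes h: "h > 0"
  shows "continuous_on UNIV (\<lambda>y. \<Sum>\<^sub>\<infinity>n::int. exp (- (y + h * n)\<^sup>2))"
proof -
  have *: "continuous_on {-R<..<R} (\<lambda>y. \<Sum>\<^sub>\<infinity>n::int. exp (- (y + h * n)\<^sup>2))" for R :: real
  proof (rule continuous_on_infsum[where M = "\<lambda>n. exp (R\<^sup>2) * exp (- (h\<^sup>2 / 2 * (of_int n)\<^sup>2))"])
    show "(\<lambda>n::int. exp (R\<^sup>2) * exp (- (h\<^sup>2 / 2 * (of_int n)\<^sup>2))) summable_on UNIV"
      by (intro summable_on_cmult_right summable_on_gaussian_int) (use h in auto)
    fix n :: int and y :: real assume "y \<in> {-R<..<R}"
    then have "\<bar>y\<bar> \<le> \<bar>R\<bar>" by auto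
    then have "y\<^sup>2 \<le> R\<^sup>2" by (simp only: abs_le_square_iff)
    moreover have "(y + h * n)\<^sup>2 \<ge> (h * n)\<^sup>2 / 2 - y\<^sup>2"
      using power2_sum_ge[of "h * n" y] by (simp add: add.commute)
    ultimately have "- (y + h * n)\<^sup>2 \<le> R\<^sup>2 + - (h\<^sup>2 / 2 * (of_int n)\<^sup>2)"
      by (simp add: power_mult_distrib)
    then show "norm (exp (- (y + h * n)\<^sup>2)) \<le> exp (R\<^sup>2) * exp (- (h\<^sup>2 / 2 * (of_int n)\<^sup>2))"
      by (simp only: exp_add[symmetric] real_norm_def abs_exp_cancel exp_le_cancel_iff)
  qed (auto intro!: continuous_intros)
  have "continuous_on (\<Union>R. {-R<..<R}) (\<lambda>y. \<Sum>\<^sub>\<infinity>n::int. exp (- (y + h * n)\<^sup>2))"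
    by (rule continuous_on_open_UN) (use * in auto)
  moreover have "(\<Union>R. {-R<..<R}) = (UNIV :: real set)"
  proof -
    have "x \<in> {-(\<bar>x\<bar> + 1)<..<\<bar>x\<bar> + 1}" for x :: real by auto
    then show ?thesis by blast
  qed
  ultimately show ?thesis by simp
qed

section \<open>Fourier coefficients of continuous functions of period 1\<close>

lemma integral_period_cis:
  fixes h s :: real and k :: int
  assumes h: "h > 0"
  shows "(\<integral>x. indicator {s..s + pi / h} x *\<^sub>R cis (2 * h * k * x) \<partial>lborel) = (if k = 0 then of_real (pi / h) else 0)"
proof (cases "k = 0")
  case True
  have "(\<integral>x. indicator {s..s + pi / h} x *\<^sub>R (1::complex) \<partial>lborel) = of_real (s + pi / h) - of_real s"
    by (rule integral_FTC_Icc) (use h in \<open>auto intro!: derivative_eq_intros\<close>)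
  then show ?thesis using True by simp
next
  case False
  let ?c = "2 * h * of_int k"
  have c: "?c \<noteq> 0" using False h by simp
  let ?F = "\<lambda>x. cis (?c * x) / (\<i> * of_real ?c)"
  have "(\<integral>x. indicator {s..s + pi / h} x *\<^sub>R cis (?c * x) \<partial>lborel) = ?F (s + pi / h) - ?F s"
  proof (rule integral_FTC_Icc)
    fix x
    have "((\<lambda>z. exp (\<i> * of_real ?c * z) / (\<i> * of_real ?c)) has_field_derivative exp (\<i> * of_real ?c * of_real x))
        (at (of_real x))"
      using c by (auto intro!: derivative_eq_intros)
    from has_vector_derivative_real_field[OF this]
    show "(?F has_vector_derivative cis (?c * x)) (at x within {s..s + pi / h})"
      by (simp add: cis_conv_exp o_def mult.assoc)
  qed (use h in \<open>auto intro!: continuous_intros\<close>)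
  also have "?F (s + pi / h) = ?F s"
  proof -
    have "?c * (s + pi / h) = ?c * s + 2 * pi * of_int k"
      using h by (simp add: distrib_left)
    moreover have "cis (?c * s + 2 * pi * of_int k) = cis (?c * s)"
      by (simp flip: cis_mult)
    ultimately show ?thesis by metis
  qed
  finally show ?thesis using False by simp
qed

lemma periodic_cis_cong:
  fixes D :: "real \<Rightarrow> 'a"
  assumes per: "\<And>t. D (t + 1) = D t" and "cis (2 * pi * a) = cis (2 * pi * b)"
  shows "D a = D b"
proof -
  have per_nat: "D (t + real n) = D t" for t and n :: nat
  proof (induction n)
    case (Suc n)
    then show ?case using per[of "t + real n"] by (simp add: algebra_simps)
  qed simp
  have per_int: "D (t + of_int m) = D t" for t and m :: int
    using per_nat[of t "nat m"] per_nat[of "t + of_int m" "nat (- m)"] by (cases "m \<ge> 0") auto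
  obtain n :: int where "2 * pi * a = 2 * pi * b + of_int (2 * n) * pi"
  proof -
    have "exp (\<i> * (2 * pi * a)) = exp (\<i> * (2 * pi * b))"
      using assms(2) by (simp add: cis_conv_exp)
    then obtain n :: int where "\<i> * of_real (2 * pi * a) = \<i> * of_real (2 * pi * b) + of_int (2 * n) * pi * \<i>"
      by (auto simp: exp_eq)
    from arg_cong[OF this, of Im] show ?thesis
      using that[of n] by simp
  qed
  then have "2 * pi * a = 2 * pi * (b + of_int n)" by (simp add: algebra_simps)
  then have "a = b + of_int n" by simp
  then show ?thesis using per_int by simp
qed

text \<open>The only obstacle is the branch cut of \<open>Arg\<close> along the negative real axis.
  Near it, Arg (- w) / (2 pi) + 1/2 is a continuous choice of the angle; it differs from Arg w / (2
  pi) by an integer, which periodicity hides.\<close>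

lemma continuous_on_circle_factor:
  fixes D :: "real \<Rightarrow> 'a::topological_space"
  assumes per: "\<And>t. D (t + 1) = D t" and cont: "continuous_on UNIV D"
  shows "continuous_on (sphere 0 1) (\<lambda>z. D (Arg z / (2 * pi)))"
proof (rule continuous_at_imp_continuous_on, rule ballI)
  fix z :: complex assume z: "z \<in> sphere 0 1"
  have D: "isCont D t" for t using cont by (simp add: continuous_on_eq_continuous_at)
  show "isCont (\<lambda>z. D (Arg z / (2 * pi))) z"
  proof (cases "z \<in> \<real>\<^sub>\<le>\<^sub>0")
    case False
    show ?thesis
      by (rule isCont_o2[of _ _ D], rule continuous_divide) (use False D in \<open>auto intro: continuous_at_Arg\<close>)
  next
    case True
    have "- z \<notin> \<real>\<^sub>\<le>\<^sub>0"
    proof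
      assume "- z \<in> \<real>\<^sub>\<le>\<^sub>0"
      then have "z = 0" using True by (auto simp: complex_nonpos_Reals_iff complex_eq_iff)
      then show False using z by simp
    qed
    then have "isCont (\<lambda>z. Arg (- z) / (2 * pi) + 1 / 2) z"
      by (intro continuous_intros isCont_o2[of _ uminus Arg] continuous_at_Arg) auto
    then have c: "isCont (\<lambda>z. D (Arg (- z) / (2 * pi) + 1 / 2)) z"
      by (rule isCont_o2) (rule D)
    have eq: "D (Arg w / (2 * pi)) = D (Arg (- w) / (2 * pi) + 1 / 2)" if "w \<noteq> 0" for w
    proof (rule periodic_cis_cong[of D, OF per])
      have "cis (2 * pi * (Arg (- w) / (2 * pi) + 1 / 2)) = cis (Arg (- w) + pi)"
        by (simp add: algebra_simps)
      also have "\<dots> = - sgn (- w)"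
        using that by (simp add: cis_mult[symmetric] cis_Arg)
      also have "\<dots> = cis (2 * pi * (Arg w / (2 * pi)))"
        using that by (simp add: cis_Arg sgn_minus)
      finally show "cis (2 * pi * (Arg w / (2 * pi))) = cis (2 * pi * (Arg (- w) / (2 * pi) + 1 / 2))" ..
    qed
    have "z \<noteq> 0" using z by auto
    then have "\<forall>\<^sub>F w in nhds z. w \<noteq> 0"
      by (rule t1_space_nhds)
    then have "\<forall>\<^sub>F w in nhds z. D (Arg (- w) / (2 * pi) + 1 / 2) = D (Arg w / (2 * pi))"
      by eventually_elim (use eq in auto)
    from isCont_cong[OF this] c show ?thesis by simp
  qed
qed

text \<open>All integer frequencies are tested at once, so that the property is stable under
  multiplication by characters; continuity is included so that integrals of sums split.\<close>

definition fourier_null :: "(real \<Rightarrow> complex) \<Rightarrow> bool" where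
  "fourier_null D \<longleftrightarrow> continuous_on UNIV D \<and> (\<forall>n::int. integral {0..1} (\<lambda>t. D t * cis (2 * pi * n * t)) = 0)"

lemma fourier_null_add:
  assumes "fourier_null D" "fourier_null E"
  shows "fourier_null (\<lambda>t. D t + E t)"
proof -
  have "integral {0..1} (\<lambda>t. (D t + E t) * cis (2 * pi * n * t))
      = integral {0..1} (\<lambda>t. D t * cis (2 * pi * n * t)) + integral {0..1} (\<lambda>t. E t * cis (2 * pi * n * t))" for n :: int
    unfolding distrib_right using assms unfolding fourier_null_def
    by (intro Henstock_Kurzweil_Integration.integral_add integrable_continuous_interval)
       (auto intro!: continuous_intros elim: continuous_on_subset)
  then show ?thesis using assms by (auto simp: fourier_null_def intro!: continuous_intros)
qed

lemma fourier_null_cmult: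
  assumes "fourier_null D"
  shows "fourier_null (\<lambda>t. D t * c)"
proof -
  have "integral {0..1} (\<lambda>t. D t * c * cis (2 * pi * n * t))
      = integral {0..1} (\<lambda>t. D t * cis (2 * pi * n * t)) * c" for n :: int
    by (simp flip: Henstock_Kurzweil_Integration.integral_mult_left add: mult_ac)
  then show ?thesis using assms by (auto simp: fourier_null_def intro!: continuous_intros)
qed

lemma fourier_null_cis:
  assumes "fourier_null D"
  shows "fourier_null (\<lambda>t. D t * cis (2 * pi * of_int m * t))"
proof -
  have "integral {0..1} (\<lambda>t. D t * cis (2 * pi * of_int m * t) * cis (2 * pi * n * t))
      = integral {0..1} (\<lambda>t. D t * cis (2 * pi * (m + n) * t))" for n :: int
    by (simp add: mult.assoc cis_mult ring_distribs)
  moreover have "integral {0..1} (\<lambda>t. D t * cis (2 * pi * (m + n) * t)) = 0" for n :: int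
    using assms unfolding fourier_null_def by (metis of_int_add)
  ultimately show ?thesis using assms by (auto simp: fourier_null_def intro!: continuous_intros)
qed

text \<open>Functions with vanishing coefficients form a module over the trigonometric polynomials.
  Since \<open>D\<close> is arbitrary in the induction, a product of polynomials acts one factor at
  a time.\<close>

lemma fourier_null_polynomial:
  assumes p: "real_polynomial_function p" and D: "fourier_null D"
  shows "fourier_null (\<lambda>t. D t * of_real (p (cis (2 * pi * t))))"
  using p D
proof (induction arbitrary: D)
  case (linear f)
  define a b where "a = f 1" and "b = f \<i>"
  have "f z = Re z * a + Im z * b" for z
  proof -
    have "f z = f (Re z *\<^sub>R 1 + Im z *\<^sub>R \<i>)"
      by (rule arg_cong[where f = f]) (simp add: complex_eq_iff)
    then show ?thesis
      using linear(1) by (simp add: a_def b_def bounded_linear_def linear_add linear_scale)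
  qed
  \<comment> \<open>Euler's formula for a cos t + b sin t: on the circle a real linear form has only
    the frequencies 1 and -1.\<close>
  then have "of_real (f (cis t)) = cis t * ((of_real a - \<i> * of_real b) / 2) + cis (- t) * ((of_real a + \<i> * of_real b) / 2)" for t
    by (simp add: complex_eq_iff field_simps)
  then have "(\<lambda>t. D t * of_real (f (cis (2 * pi * t))))
     = (\<lambda>t. D t * cis (2 * pi * of_int 1 * t) * ((of_real a - \<i> * of_real b) / 2)
          + D t * cis (2 * pi * of_int (- 1) * t) * ((of_real a + \<i> * of_real b) / 2))"
    by (simp add: ring_distribs mult.assoc)
  then show ?case
    using linear(2) by (simp only: fourier_null_add fourier_null_cmult fourier_null_cis)
next
  case (const c)
  then show ?case by (rule fourier_null_cmult)
next
  case (add f g)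
  then show ?case by (simp add: distrib_left fourier_null_add)
next
  case (mult f g)
  from mult.IH(2)[OF mult.IH(1)[OF mult.prems]] show ?case by (simp add: mult.assoc)
qed

text \<open>By Stone--Weierstrass \<open>D\<close> is a uniform limit of trigonometric polynomials, to all of which
  it is orthogonal; hence it is orthogonal to itself.\<close>

lemma fourier_null_periodic_eq_0:
  fixes D :: "real \<Rightarrow> complex"
  assumes null: "fourier_null D" and per: "\<And>t. D (t + 1) = D t"
  shows "D t = 0"
proof -
  have cont: "continuous_on UNIV D" using null by (simp add: fourier_null_def)
  then have cont01: "continuous_on {0..1} D" by (rule continuous_on_subset) auto
  then have contn: "continuous_on {0..1} (\<lambda>t. (cmod (D t))\<^sup>2)" by (intro continuous_intros)
  have "bounded (D ` {0..1})"
    using compact_imp_bounded[OF compact_continuous_image[OF cont01 compact_Icc]] .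
  then obtain B where B: "B > 0" "\<And>t. t \<in> {0..1} \<Longrightarrow> cmod (D t) \<le> B"
    unfolding bounded_pos by auto
  have small: "integral {0..1} (\<lambda>t. (cmod (D t))\<^sup>2) \<le> e * B" if e: "e > 0" for e
  proof -
    obtain p where p: "polynomial_function p"
      and approx: "\<And>z. z \<in> sphere 0 1 \<Longrightarrow> cmod (D (Arg z / (2 * pi)) - p z) < e"
      using Stone_Weierstrass_polynomial_function[OF compact_sphere continuous_on_circle_factor[of D, OF per cont] e]
      by blast
    define P where "P t = p (cis (2 * pi * t))" for t
    have PD: "cmod (D t - P t) < e" for t
    proof -
      have "D (Arg (cis (2 * pi * t)) / (2 * pi)) = D t"
        by (rule periodic_cis_cong[of D, OF per]) (simp add: cis_Arg)
      then show ?thesis using approx[of "cis (2 * pi * t)"] by (simp add: P_def)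
    qed
    have re: "real_polynomial_function (Re \<circ> p)" "real_polynomial_function (Im \<circ> p)"
      using p bounded_linear_Re bounded_linear_Im unfolding polynomial_function_def by auto
    \<comment> \<open>The preceding induction covers real polynomial functions only; the conjugate
      of \<open>P\<close> is reached as real part minus \<i> times imaginary part.\<close>
    have "fourier_null (\<lambda>t. D t * of_real ((Re \<circ> p) (cis (2 * pi * t))) + D t * of_real ((Im \<circ> p) (cis (2 * pi * t))) * (- \<i>))"
      by (intro fourier_null_add fourier_null_cmult fourier_null_polynomial re null)
    also have "(\<lambda>t. D t * of_real ((Re \<circ> p) (cis (2 * pi * t))) + D t * of_real ((Im \<circ> p) (cis (2 * pi * t))) * (- \<i>))
       = (\<lambda>t. D t * cnj (P t))"
      by (auto simp: fun_eq_iff P_def complex_eq_iff)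
    finally have Pnull: "fourier_null (\<lambda>t. D t * cnj (P t))" .
    then have P0: "integral {0..1} (\<lambda>t. D t * cnj (P t)) = 0"
      unfolding fourier_null_def by (auto dest!: spec[of _ 0])
    have contP: "continuous_on {0..1} (\<lambda>t. D t * cnj (P t))"
      using Pnull by (auto simp: fourier_null_def elim: continuous_on_subset)
    have "of_real (integral {0..1} (\<lambda>t. (cmod (D t))\<^sup>2)) = integral {0..1} (\<lambda>t. D t * cnj (D t))"
      using integral_linear[OF integrable_continuous_interval[OF contn] bounded_linear_of_real[where 'a = complex]]
      by (simp add: o_def complex_norm_square[symmetric])
    \<comment> \<open>Subtracting an integral that vanishes turns the second factor into the
      conjugate of D - P, which is uniformly below \<open>e\<close>.\<close>
    also have "\<dots> = integral {0..1} (\<lambda>t. D t * cnj (D t)) - integral {0..1} (\<lambda>t. D t * cnj (P t))"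
      by (simp add: P0)
    also have "\<dots> = integral {0..1} (\<lambda>t. D t * cnj (D t) - D t * cnj (P t))"
      by (rule Henstock_Kurzweil_Integration.integral_diff[symmetric])
         (auto intro!: integrable_continuous_interval contP continuous_intros cont01)
    finally have "integral {0..1} (\<lambda>t. (cmod (D t))\<^sup>2) \<le> cmod (integral {0..1} (\<lambda>t. D t * cnj (D t) - D t * cnj (P t)))"
      by (metis abs_ge_self norm_of_real)
    also have "\<dots> \<le> B * e * (1 - 0)"
    proof (rule integral_bound)
      show "continuous_on {0..1} (\<lambda>t. D t * cnj (D t) - D t * cnj (P t))"
        by (intro continuous_intros contP cont01)
      fix t :: real assume t: "t \<in> {0..1}"
      have "cmod (D t * cnj (D t) - D t * cnj (P t)) = cmod (D t) * cmod (D t - P t)"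
        by (metis complex_cnj_diff complex_mod_cnj norm_mult right_diff_distrib)
      also have "\<dots> \<le> B * e"
        using B t PD[of t] by (intro mult_mono) auto
      finally show "cmod (D t * cnj (D t) - D t * cnj (P t)) \<le> B * e" .
    qed simp
    finally show ?thesis by (simp add: mult.commute)
  qed
  have "integral {0..1} (\<lambda>t. (cmod (D t))\<^sup>2) \<le> 0"
  proof (rule field_le_epsilon)
    fix e :: real assume "e > 0"
    then show "integral {0..1} (\<lambda>t. (cmod (D t))\<^sup>2) \<le> 0 + e"
      using small[of "e / B"] B(1) by simp
  qed
  moreover have "integral {0..1} (\<lambda>t. (cmod (D t))\<^sup>2) \<ge> 0"
    by (rule Henstock_Kurzweil_Integration.integral_nonneg) (auto intro!: integrable_continuous_interval contn)
  ultimately have "\<forall>t\<in>{0..1}. (cmod (D t))\<^sup>2 = 0"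
    using integral_eq_0_iff[OF contn] by auto
  moreover have "D t = D (frac t)"
  proof (rule periodic_cis_cong[of D, OF per])
    have "2 * pi * t = 2 * pi * frac t + 2 * pi * of_int \<lfloor>t\<rfloor>"
      by (simp add: frac_def algebra_simps)
    then show "cis (2 * pi * t) = cis (2 * pi * frac t)"
      by (simp add: cis_mult[symmetric])
  qed
  ultimately show ?thesis using frac_ge_0[of t] frac_lt_1[of t] by simp
qed

section \<open>Poisson summation for Gaussians\<close>

lemma integral_eq_lborel_Icc:
  fixes f :: "real \<Rightarrow> complex"
  assumes "continuous_on {a..b} f"
  shows "integral {a..b} f = (\<integral>t. indicator {a..b} t *\<^sub>R f t \<partial>lborel)"
  using set_borel_integral_eq_integral(2)[OF borel_integrable_atLeastAtMost'[OF assms]]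
  by (simp add: set_lebesgue_integral_def)

lemma integrable_lborel_indicator_Icc:
  "integrable lborel (\<lambda>t. indicator {a..b::real} t * (c::real))"
  by (auto simp: emeasure_lborel_Icc_eq)

text \<open>The periodized Gaussian \<open>F\<close> and the series \<open>G\<close> are continuous,
  have period 1 and share the coefficients \<open>w n\<close>, hence coincide. For \<open>F\<close>
  the coefficients come from unfolding the unit interval to the line, for \<open>G\<close> from
  orthogonality of characters.\<close>

lemma poisson_gaussian:
  fixes g s :: real
  assumes g: "g > 0"
  shows "of_real (\<Sum>\<^sub>\<infinity>l::int. exp (- (g * s + g * l)\<^sup>2)) =
    of_real (sqrt pi / g) * (\<Sum>\<^sub>\<infinity>q::int. of_real (exp (- ((pi / g)\<^sup>2 * (of_int q)\<^sup>2))) * cis (2 * pi * q * s))"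
proof -
  define F where "F t = (\<Sum>\<^sub>\<infinity>l::int. exp (- (g * t + g * l)\<^sup>2))" for t
  define w where "w q = sqrt pi / g * exp (- ((pi / g)\<^sup>2 * (of_int q)\<^sup>2))" for q :: int
  define G where "G t = (\<Sum>\<^sub>\<infinity>q::int. of_real (w q) * cis (2 * pi * q * t))" for t
  have w: "w summable_on UNIV"
    unfolding w_def by (intro summable_on_cmult_right summable_on_gaussian_int) (use g in auto)
  have wpos: "w q \<ge> 0" for q
    unfolding w_def using g by simp
  have contF: "continuous_on UNIV F"
    unfolding F_def
    using continuous_on_compose2[OF continuous_on_gaussian_translates[OF g], of UNIV "\<lambda>t. g * t"]
    by (auto intro!: continuous_intros)
  have contG: "continuous_on UNIV G"
    unfolding G_def
    by (rule continuous_on_infsum[OF _ _ w])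
       (use wpos in \<open>auto simp: norm_mult intro!: continuous_intros\<close>)
  have perF: "F (t + 1) = F t" for t
  proof -
    have bij: "bij_betw (\<lambda>l::int. l + 1) UNIV UNIV"
      by (rule bij_betw_byWitness[of _ "\<lambda>n. n - 1"]) auto
    show ?thesis
      unfolding F_def
      using infsum_reindex_bij_betw[OF bij, of "\<lambda>l. exp (- (g * t + g * of_int l)\<^sup>2)"]
      by (simp add: algebra_simps)
  qed
  have perG: "G (t + 1) = G t" for t
  proof -
    have "cis (2 * pi * of_int q * (t + 1)) = cis (2 * pi * of_int q * t)" for q :: int
      by (simp add: distrib_left flip: cis_mult)
    then show ?thesis by (simp add: G_def)
  qed
  have coeffF: "integral {0..1} (\<lambda>t. of_real (F t) * cis (2 * pi * of_int n * t)) = of_real (w n)" for n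
  proof -
    define f where "f y = of_real (exp (- (g * y)\<^sup>2)) * cis (2 * pi * of_int n * y)" for y
    have "has_bochner_integral lborel (\<lambda>y::real. exp (- of_real (g\<^sup>2 * y\<^sup>2) + (2 * pi * n * \<i>) * of_real y))
           (of_real (sqrt (pi / g\<^sup>2)) * exp ((2 * pi * n * \<i>)\<^sup>2 / of_real (4 * g\<^sup>2)))"
      by (rule has_bochner_integral_gaussian) (use g in auto)
    moreover have "exp (- of_real (g\<^sup>2 * y\<^sup>2) + (2 * pi * n * \<i>) * of_real y) = f y" for y
      by (simp add: f_def cis_conv_exp exp_of_real[symmetric] mult_exp_exp power_mult_distrib mult_ac)
    moreover have "of_real (sqrt (pi / g\<^sup>2)) * exp ((2 * pi * n * \<i>)\<^sup>2 / of_real (4 * g\<^sup>2)) = of_real (w n)"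
    proof -
      have *: "(2 * pi * n * \<i>)\<^sup>2 / of_real (4 * g\<^sup>2) = of_real (- ((pi / g)\<^sup>2 * (of_int n)\<^sup>2))"
        using g by (simp add: power_mult_distrib power_divide)
      show ?thesis
        unfolding * exp_of_real using g by (simp add: w_def real_sqrt_divide)
    qed
    ultimately have f: "has_bochner_integral lborel f (of_real (w n))" by simp
    have per: "((\<lambda>m::int. \<integral>y. indicator {0..1} y *\<^sub>R f (y + m) \<partial>lborel) has_sum of_real (w n)) UNIV"
      using has_sum_periodization[of f 1 1] f by (simp add: has_bochner_integral_iff)
    \<comment> \<open>The same sum of integrals is evaluated twice: \<open>per\<close> unfolds it to
      an integral over the line, here it becomes the integral of the sum.\<close>
    have "((\<lambda>m::int. \<integral>y. indicator {0..1} y *\<^sub>R f (y + m) \<partial>lborel) has_sum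
            (\<integral>y. (\<Sum>\<^sub>\<infinity>m::int. indicator {0..1} y *\<^sub>R f (y + m)) \<partial>lborel)) UNIV"
    proof (rule has_sum_integral[where g = "\<lambda>y. indicator {0..1} y * gauss_bound g"])
      have norm: "norm (indicator {0..1} y *\<^sub>R f (y + m)) = indicator {0..1} y * exp (- (g * y + g * m)\<^sup>2)" for y :: real and m :: int
        by (simp add: f_def norm_mult distrib_left)
      show "(\<lambda>m::int. norm (indicator {0..1} y *\<^sub>R f (y + m))) summable_on UNIV" for y
        unfolding norm by (intro summable_on_cmult_right gaussian_translates g)
      show "(\<Sum>\<^sub>\<infinity>m::int. norm (indicator {0..1} y *\<^sub>R f (y + m))) \<le> indicator {0..1} y * gauss_bound g" for y
        unfolding norm infsum_cmult_right' by (intro mult_left_mono gaussian_translates g) auto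
      show "(\<lambda>y. indicator {0..1} y *\<^sub>R f (y + of_int m)) \<in> borel_measurable lborel" for m
        using f by (auto simp: has_bochner_integral_iff)
    qed (auto intro: integrable_lborel_indicator_Icc simp: infinite_UNIV_int)
    then have "of_real (w n) = (\<integral>y. (\<Sum>\<^sub>\<infinity>m::int. indicator {0..1} y *\<^sub>R f (y + m)) \<partial>lborel)"
      using per has_sum_unique by blast
    also have "(\<lambda>y. \<Sum>\<^sub>\<infinity>m::int. indicator {0..1} y *\<^sub>R f (y + m))
        = (\<lambda>y. indicator {0..1} y *\<^sub>R (of_real (F y) * cis (2 * pi * of_int n * y)))"
    proof
      fix y :: real
      have f: "f (y + m) = of_real (exp (- (g * y + g * m)\<^sup>2)) * cis (2 * pi * of_int n * y)" for m :: int
      proof -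
        have "2 * pi * n * (y + m) = 2 * pi * n * y + 2 * pi * of_int (n * m)" by (simp add: algebra_simps)
        then have "cis (2 * pi * n * (y + m)) = cis (2 * pi * n * y)"
          by (simp only: cis_mult[symmetric] cis_multiple_2pi Ints_of_int mult_1_right)
        then show ?thesis by (simp add: f_def distrib_left)
      qed
      have "((\<lambda>m::int. of_real (exp (- (g * y + g * m)\<^sup>2)) * cis (2 * pi * of_int n * y)) has_sum
          of_real (F y) * cis (2 * pi * of_int n * y)) UNIV"
        unfolding F_def by (intro has_sum_cmult_left has_sum_of_real has_sum_infsum gaussian_translates g)
      then have "(\<Sum>\<^sub>\<infinity>m::int. f (y + m)) = of_real (F y) * cis (2 * pi * of_int n * y)"
        unfolding f by (rule infsumI)
      then show "(\<Sum>\<^sub>\<infinity>m::int. indicator {0..1} y *\<^sub>R f (y + m)) = indicator {0..1} y *\<^sub>R (of_real (F y) * cis (2 * pi * of_int n * y))"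
        by (simp add: infsum_scaleR_right)
    qed
    also have "(\<integral>y. indicator {0..1} y *\<^sub>R (of_real (F y) * cis (2 * pi * of_int n * y)) \<partial>lborel)
        = integral {0..1} (\<lambda>t. of_real (F t) * cis (2 * pi * of_int n * t))"
      by (rule integral_eq_lborel_Icc[symmetric])
         (auto intro!: continuous_intros continuous_on_subset[OF contF])
    finally show ?thesis ..
  qed
  have coeffG: "integral {0..1} (\<lambda>t. G t * cis (2 * pi * of_int n * t)) = of_real (w n)" for n
  proof -
    let ?f = "\<lambda>q t. indicator {0..1} t *\<^sub>R (of_real (w q) * cis (2 * pi * of_int (q + n) * t))"
    have "((\<lambda>q. \<integral>t. ?f q t \<partial>lborel) has_sum (\<integral>t. (\<Sum>\<^sub>\<infinity>q. ?f q t) \<partial>lborel)) UNIV"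
    proof (rule has_sum_integral[where g = "\<lambda>y. indicator {0..1} y * infsum w UNIV"])
      have norm: "norm (?f q t) = indicator {0..1} t * w q" for q t
        using wpos by (simp add: norm_mult)
      show "(\<lambda>q. norm (?f q t)) summable_on UNIV" for t
        unfolding norm by (intro summable_on_cmult_right w)
      show "(\<Sum>\<^sub>\<infinity>q. norm (?f q t)) \<le> indicator {0..1} t * infsum w UNIV" for t
        unfolding norm infsum_cmult_right' by simp
    qed (auto intro: integrable_lborel_indicator_Icc simp: infinite_UNIV_int cis_conv_exp)
    \<comment> \<open>The test character carries a plus sign, so the resonant index is - n; the
      value is still \<open>w n\<close> because \<open>w\<close> is even.\<close>
    moreover have "(\<integral>t. ?f q t \<partial>lborel) = (if q = - n then of_real (w n) else 0)" for q
    proof -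
      have "(\<integral>t. ?f q t \<partial>lborel) = (\<integral>t. of_real (w q) * (indicator {0..1} t *\<^sub>R cis (2 * pi * of_int (q + n) * t)) \<partial>lborel)"
        by (simp add: mult_scaleR_right)
      also have "\<dots> = of_real (w q) * (if q + n = 0 then 1 else 0)"
        unfolding integral_mult_right_zero using integral_period_cis[of pi 0 "q + n"] by simp
      also have "\<dots> = (if q = - n then of_real (w n) else 0)"
        by (auto simp: w_def)
      finally show ?thesis .
    qed
    ultimately have "((\<lambda>q. if q = - n then complex_of_real (w n) else 0) has_sum (\<integral>t. (\<Sum>\<^sub>\<infinity>q. ?f q t) \<partial>lborel)) UNIV"
      by simp
    moreover have "((\<lambda>q. if q = - n then complex_of_real (w n) else 0) has_sum of_real (w n)) UNIV"
      by (rule has_sum_finite_neutralI[of "{- n}"]) auto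
    ultimately have "(\<integral>t. (\<Sum>\<^sub>\<infinity>q. ?f q t) \<partial>lborel) = of_real (w n)"
      using has_sum_unique by blast
    moreover have "(\<Sum>\<^sub>\<infinity>q. ?f q t) = indicator {0..1} t *\<^sub>R (G t * cis (2 * pi * of_int n * t))" for t
    proof -
      have "of_real (w q) * cis (2 * pi * of_int (q + n) * t) = (of_real (w q) * cis (2 * pi * of_int q * t)) * cis (2 * pi * of_int n * t)" for q
        by (simp add: cis_mult algebra_simps)
      then show ?thesis
        unfolding G_def by (simp only: infsum_scaleR_right infsum_cmult_left')
    qed
    ultimately have "(\<integral>t. indicator {0..1} t *\<^sub>R (G t * cis (2 * pi * of_int n * t)) \<partial>lborel) = of_real (w n)"
      by simp
    then show ?thesis
      by (subst integral_eq_lborel_Icc) (auto intro!: continuous_intros continuous_on_subset[OF contG])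
  qed
  have "of_real (F s) - G s = 0"
  proof (rule fourier_null_periodic_eq_0[where D = "\<lambda>t. of_real (F t) - G t"])
    have "integral {0..1} (\<lambda>t. (of_real (F t) - G t) * cis (2 * pi * of_int n * t)) = 0" for n :: int
    proof -
      have "integral {0..1} (\<lambda>t. (of_real (F t) - G t) * cis (2 * pi * of_int n * t)) =
          integral {0..1} (\<lambda>t. of_real (F t) * cis (2 * pi * of_int n * t)) - integral {0..1} (\<lambda>t. G t * cis (2 * pi * of_int n * t))"
        unfolding left_diff_distrib
        by (intro Henstock_Kurzweil_Integration.integral_diff integrable_continuous_interval)
           (auto intro!: continuous_intros continuous_on_subset[OF contG] continuous_on_subset[OF contF])
      then show ?thesis by (simp add: coeffF coeffG)
    qed
    then show "fourier_null (\<lambda>t. of_real (F t) - G t)"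
      unfolding fourier_null_def by (auto intro!: continuous_intros contF contG)
  qed (simp add: perF perG)
  moreover have "G s = of_real (sqrt pi / g) * (\<Sum>\<^sub>\<infinity>q::int. of_real (exp (- ((pi / g)\<^sup>2 * (of_int q)\<^sup>2))) * cis (2 * pi * q * s))"
    unfolding G_def w_def by (simp add: infsum_cmult_right'[symmetric] mult.assoc)
  ultimately show ?thesis by (simp add: F_def)
qed

section \<open>Theta sums\<close>

text \<open>An entire function times exp (- |z|^2 / 2), the shape of the lowest Landau level;
  \<open>wave_eq\<close> gives the form as plane wave times Gaussian in the imaginary part.\<close>

definition wave :: "real \<Rightarrow> int \<Rightarrow> complex \<Rightarrow> complex" where
  "wave h n z = exp (z\<^sup>2 / 2 - of_real ((cmod z)\<^sup>2) / 2 + 2 * \<i> * of_real (h * n) * z - of_real ((h * n)\<^sup>2))"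

lemma wave_eq: "wave h n z = of_real (exp (- (Im z + h * n)\<^sup>2)) * cis (Re z * Im z + 2 * h * n * Re z)"
proof -
  have "z\<^sup>2 / 2 - of_real ((cmod z)\<^sup>2) / 2 + 2 * \<i> * of_real (h * n) * z - of_real ((h * n)\<^sup>2)
      = of_real (- (Im z + h * n)\<^sup>2) + \<i> * of_real (Re z * Im z + 2 * h * n * Re z)"
    unfolding cmod_power2 by (simp add: complex_eq_iff power2_eq_square algebra_simps)
  then show ?thesis by (simp only: wave_def exp_add exp_of_real cis_conv_exp)
qed

lemma norm_wave: "cmod (wave h n z) = exp (- (Im z + h * n)\<^sup>2)"
  by (simp add: wave_eq norm_mult)

lemma continuous_on_wave: "continuous_on A (wave h n)"
  unfolding wave_def by (intro continuous_intros) auto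

text \<open>The modulus of the kernel splits into a factor in the real part and one in the imaginary
  part of \<open>w\<close>, so its integrability reduces to Gaussians on the line.\<close>

lemma norm_exp_cnj_mult:
  "cmod (exp (cnj w * z - of_real ((cmod w)\<^sup>2) / 2))
     = exp (- (1/2 * (Re w)\<^sup>2) + Re z * Re w) * exp (- (1/2 * (Im w)\<^sup>2) + Im z * Im w)"
  unfolding cmod_power2 by (simp add: exp_add[symmetric] algebra_simps)

lemma integrable_gaussian:
  fixes a b :: real
  assumes "a > 0"
  shows "integrable lborel (\<lambda>x. exp (- (a * x\<^sup>2) + b * x))"
proof -
  have "integrable lborel (\<lambda>x::real. exp (- of_real (a * x\<^sup>2) + of_real b * of_real x :: complex))"
    using has_bochner_integral_gaussian[OF assms, of "of_real b"] by (simp add: has_bochner_integral_iff)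
  then have "integrable lborel (\<lambda>x::real. cmod (exp (- of_real (a * x\<^sup>2) + of_real b * of_real x)))"
    by (rule integrable_norm)
  then show ?thesis by simp
qed

lemma integrable_exp_cnj_mult:
  "integrable lborel (\<lambda>w. cmod (exp (cnj w * z - of_real ((cmod w)\<^sup>2) / 2)))"
  unfolding norm_exp_cnj_mult
  by (rule integrable_lborel_complex_mult) (rule integrable_gaussian, simp)+

text \<open>The four centres lie symmetrically about their mean, at distances h |p + q| / 2 and h |p
  - q| / 2, each occurring twice. The sum of the four squares is thus 4 times the squared distance
  of \<open>y\<close> to the mean plus h^2 (p^2 + q^2), and \<open>m\<close> only translates the
  picture.\<close>

lemma gaussian_quad_sum:
  fixes h :: real and m p q :: int
  shows "has_bochner_integral lborel
     (\<lambda>y. of_real (exp (- (y + h * m)\<^sup>2 - (y + h * (m + p))\<^sup>2 - (y + h * (m + q))\<^sup>2 - (y + h * (m + p + q))\<^sup>2)))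
     (of_real (sqrt pi / 2 * exp (- (h\<^sup>2 * (of_int p)\<^sup>2) - h\<^sup>2 * (of_int q)\<^sup>2)) :: complex)"
proof -
  let ?b = "- 4 * h * (2 * m + p + q)"
  let ?c = "h\<^sup>2 * ((of_int m)\<^sup>2 + (of_int (m + p))\<^sup>2 + (of_int (m + q))\<^sup>2 + (of_int (m + p + q))\<^sup>2)"
  have e1: "- (y + h * m)\<^sup>2 - (y + h * (m + p))\<^sup>2 - (y + h * (m + q))\<^sup>2 - (y + h * (m + p + q))\<^sup>2
      = - (4 * y\<^sup>2) + ?b * y + - ?c" for y
    by (simp add: power2_eq_square algebra_simps)
  have e2: "?b\<^sup>2 / 16 + - ?c = - (h\<^sup>2 * (of_int p)\<^sup>2) - h\<^sup>2 * (of_int q)\<^sup>2"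
    by (simp add: power2_eq_square field_simps)
  have "has_bochner_integral lborel (\<lambda>y::real. exp (- of_real (4 * y\<^sup>2) + of_real ?b * of_real y))
           (of_real (sqrt (pi / 4)) * exp ((of_real ?b)\<^sup>2 / of_real (4 * 4) :: complex))"
    by (rule has_bochner_integral_gaussian) simp
  then have *: "has_bochner_integral lborel (\<lambda>y::real. exp (- of_real (4 * y\<^sup>2) + of_real ?b * of_real y) * exp (of_real (- ?c)))
           (of_real (sqrt (pi / 4)) * exp ((of_real ?b)\<^sup>2 / of_real (4 * 4) :: complex) * exp (of_real (- ?c)))"
    by (rule has_bochner_integral_mult_left)
  have e3: "exp (- of_real (4 * y\<^sup>2) + of_real ?b * of_real y) * exp (of_real (- ?c))
     = (of_real (exp (- (4 * y\<^sup>2) + ?b * y + - ?c)) :: complex)" for y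
    unfolding exp_of_real[symmetric] exp_add[symmetric] by (rule arg_cong[where f = exp]) simp
  have e4: "of_real (sqrt (pi / 4)) * exp ((of_real ?b)\<^sup>2 / of_real (4 * 4)) * exp (of_real (- ?c))
     = (of_real (sqrt pi / 2 * exp (?b\<^sup>2 / 16 + - ?c)) :: complex)"
  proof -
    have "exp ((of_real ?b)\<^sup>2 / of_real (4 * 4)) * exp (of_real (- ?c)) = (of_real (exp (?b\<^sup>2 / 16 + - ?c)) :: complex)"
      unfolding exp_of_real[symmetric] exp_add[symmetric] by (rule arg_cong[where f = exp]) simp
    then show ?thesis by (simp only: mult.assoc) (simp add: real_sqrt_divide)
  qed
  show ?thesis using * unfolding e1 e2[symmetric] e3 e4 .
qed

definition theta_term :: "real \<Rightarrow> real \<Rightarrow> real \<Rightarrow> complex \<Rightarrow> int \<Rightarrow> complex" where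
  "theta_term h \<theta> \<nu> z n = cis (\<theta> * (of_int n)\<^sup>2 + \<nu> * of_int n) * wave h n z"

definition theta_sum :: "real \<Rightarrow> real \<Rightarrow> real \<Rightarrow> complex \<Rightarrow> complex" where
  "theta_sum h \<theta> \<nu> z = (\<Sum>\<^sub>\<infinity>n. theta_term h \<theta> \<nu> z n)"

text \<open>Complex-valued because it arises as the coefficient in a complex identity; that it is
  real emerges only when it is evaluated, in general by Poisson summation.\<close>

definition twisted_sum :: "real \<Rightarrow> real \<Rightarrow> complex" where
  "twisted_sum h \<theta> = (\<Sum>\<^sub>\<infinity>(p::int, q::int)\<in>UNIV.
     cis (- 2 * \<theta> * of_int p * of_int q) * of_real (exp (- (h\<^sup>2 * (of_int p)\<^sup>2) - h\<^sup>2 * (of_int q)\<^sup>2)))"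

lemma twisted_sum_abs_summable:
  assumes h: "h > 0"
  shows "(\<lambda>x. norm ((\<lambda>(p::int, q::int). cis (- 2 * \<theta> * of_int p * of_int q) * of_real (exp (- (h\<^sup>2 * (of_int p)\<^sup>2) - h\<^sup>2 * (of_int q)\<^sup>2))) x)) summable_on UNIV"
proof -
  have "(\<lambda>n::int. norm (exp (- (h\<^sup>2 * (of_int n)\<^sup>2)))) summable_on UNIV"
    using summable_on_gaussian_int[of "h\<^sup>2"] h by simp
  moreover have "exp (- a - b) = exp (- a) * exp (- b)" for a b :: real
    by (simp add: exp_diff exp_minus field_simps)
  ultimately show ?thesis
    using has_sum_times(2)[of "\<lambda>n::int. exp (- (h\<^sup>2 * (of_int n)\<^sup>2))" UNIV "\<lambda>n::int. exp (- (h\<^sup>2 * (of_int n)\<^sup>2))" UNIV]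
    by (simp add: case_prod_unfold norm_mult)
qed

section \<open>Absolutely convergent expansions of products of the theta sum\<close>

locale gaussian_theta =
  fixes h \<theta> \<nu> :: real
  assumes h: "h > 0"
begin

abbreviation "T \<equiv> theta_term h \<theta> \<nu>"
abbreviation "u \<equiv> theta_sum h \<theta> \<nu>"
abbreviation "B \<equiv> gauss_bound h"

lemma norm_theta_term: "cmod (T z n) = exp (- (Im z + h * n)\<^sup>2)"
  by (simp add: theta_term_def norm_mult norm_wave)

lemma norm_theta_term_le_1: "cmod (T z n) \<le> 1"
  by (simp add: norm_theta_term)

lemma theta_term_summable: "(\<lambda>n. norm (T z n)) summable_on UNIV"
  and theta_term_norm_le: "(\<Sum>\<^sub>\<infinity>n. norm (T z n)) \<le> B"
  unfolding norm_theta_term using gaussian_translates[OF h] by auto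

lemma theta_term_norm_ge: "0 \<le> (\<Sum>\<^sub>\<infinity>n. norm (T z n))"
  by (rule infsum_nonneg) simp

lemma norm_theta_sum_le: "cmod (u z) \<le> B"
  unfolding theta_sum_def
  using norm_infsum_bound[OF theta_term_summable, of z] theta_term_norm_le[of z] by simp

lemma continuous_on_theta_term [continuous_intros]: "continuous_on A (\<lambda>z. T z n)"
  unfolding theta_term_def by (intro continuous_intros continuous_on_wave)

lemma borel_measurable_theta_term [measurable]: "(\<lambda>z. T z n) \<in> borel_measurable borel"
  by (rule borel_measurable_continuous_onI) (rule continuous_on_theta_term)

lemma borel_measurable_theta_sum [measurable]: "u \<in> borel_measurable borel"
  unfolding theta_sum_def
  by (rule borel_measurable_infsum) (auto simp: infinite_UNIV_int intro: abs_summable_summable theta_term_summable)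

text \<open>The norms are summed along with the terms: their sum is a power of one series that is at
  most \<open>B\<close>, which provides the constants for dominated integration.\<close>

lemma theta_pair:
  "((\<lambda>(i,j). T z i * cnj (T z j)) has_sum u z * cnj (u z)) UNIV"
  "((\<lambda>(i,j). norm (T z i * cnj (T z j))) has_sum (\<Sum>\<^sub>\<infinity>n. norm (T z n))\<^sup>2) UNIV"
proof -
  have n: "(\<lambda>n. norm (cnj (T z n))) summable_on UNIV"
    using theta_term_summable[of z] by simp
  show "((\<lambda>(i,j). T z i * cnj (T z j)) has_sum u z * cnj (u z)) UNIV"
    using has_sum_times(1)[OF theta_term_summable[of z] n] by (simp add: theta_sum_def)
  have nn: "(\<lambda>n. norm (norm (T z n))) summable_on UNIV"
    using theta_term_summable[of z] by simp
  show "((\<lambda>(i,j). norm (T z i * cnj (T z j))) has_sum (\<Sum>\<^sub>\<infinity>n. norm (T z n))\<^sup>2) UNIV"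
    using has_sum_times(1)[OF nn nn] by (simp add: norm_mult power2_eq_square)
qed

lemma theta_triple:
  "((\<lambda>((i,j),k). T z i * cnj (T z j) * T z k) has_sum u z * cnj (u z) * u z) UNIV"
  "((\<lambda>((i,j),k). norm (T z i * cnj (T z j) * T z k)) has_sum (\<Sum>\<^sub>\<infinity>n. norm (T z n)) ^ 3) UNIV"
proof -
  have n: "(\<lambda>x. norm ((\<lambda>(i,j). T z i * cnj (T z j)) x)) summable_on UNIV"
    using theta_pair(2)[of z] by (auto simp: summable_on_def case_prod_unfold)
  have "((\<lambda>(x,k). (\<lambda>(i,j). T z i * cnj (T z j)) x * T z k) has_sum u z * cnj (u z) * u z) UNIV"
    using has_sum_times(1)[OF n theta_term_summable[of z]] theta_pair(1)[of z]
    by (simp add: theta_sum_def infsumI)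
  then show "((\<lambda>((i,j),k). T z i * cnj (T z j) * T z k) has_sum u z * cnj (u z) * u z) UNIV"
    by (simp add: case_prod_unfold)
  have n': "(\<lambda>x. norm ((\<lambda>(i,j). norm (T z i * cnj (T z j))) x)) summable_on UNIV"
    using theta_pair(2)[of z] by (auto simp: summable_on_def case_prod_unfold)
  have nn: "(\<lambda>n. norm (norm (T z n))) summable_on UNIV"
    using theta_term_summable[of z] by simp
  have "((\<lambda>(x,k). (\<lambda>(i,j). norm (T z i * cnj (T z j))) x * norm (T z k)) has_sum (\<Sum>\<^sub>\<infinity>n. norm (T z n))\<^sup>2 * (\<Sum>\<^sub>\<infinity>n. norm (T z n))) UNIV"
    using has_sum_times(1)[OF n' nn] infsumI[OF theta_pair(2)[of z]] by simp
  then show "((\<lambda>((i,j),k). norm (T z i * cnj (T z j) * T z k)) has_sum (\<Sum>\<^sub>\<infinity>n. norm (T z n)) ^ 3) UNIV"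
    by (simp add: case_prod_unfold norm_mult power3_eq_cube power2_eq_square)
qed

lemma theta_quadruple:
  "((\<lambda>(((i,j),k),l). T z i * cnj (T z j) * T z k * cnj (T z l)) has_sum u z * cnj (u z) * u z * cnj (u z)) UNIV"
  "((\<lambda>(((i,j),k),l). norm (T z i * cnj (T z j) * T z k * cnj (T z l))) has_sum (\<Sum>\<^sub>\<infinity>n. norm (T z n)) ^ 4) UNIV"
proof -
  have n: "(\<lambda>x. norm ((\<lambda>((i,j),k). T z i * cnj (T z j) * T z k) x)) summable_on UNIV"
    using theta_triple(2)[of z] by (auto simp: summable_on_def case_prod_unfold)
  have nc: "(\<lambda>n. norm (cnj (T z n))) summable_on UNIV"
    using theta_term_summable[of z] by simp
  have "((\<lambda>(x,l). (\<lambda>((i,j),k). T z i * cnj (T z j) * T z k) x * cnj (T z l)) has_sum u z * cnj (u z) * u z * cnj (u z)) UNIV"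
    using has_sum_times(1)[OF n nc] infsumI[OF theta_triple(1)[of z]]
    by (simp add: theta_sum_def)
  then show "((\<lambda>(((i,j),k),l). T z i * cnj (T z j) * T z k * cnj (T z l)) has_sum u z * cnj (u z) * u z * cnj (u z)) UNIV"
    by (simp add: case_prod_unfold)
  have n': "(\<lambda>x. norm ((\<lambda>((i,j),k). norm (T z i * cnj (T z j) * T z k)) x)) summable_on UNIV"
    using theta_triple(2)[of z] by (auto simp: summable_on_def case_prod_unfold)
  have nn: "(\<lambda>n. norm (norm (T z n))) summable_on UNIV"
    using theta_term_summable[of z] by simp
  have "((\<lambda>(x,l). (\<lambda>((i,j),k). norm (T z i * cnj (T z j) * T z k)) x * norm (T z l)) has_sum (\<Sum>\<^sub>\<infinity>n. norm (T z n)) ^ 3 * (\<Sum>\<^sub>\<infinity>n. norm (T z n))) UNIV"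
    using has_sum_times(1)[OF n' nn] infsumI[OF theta_triple(2)[of z]] by simp
  then show "((\<lambda>(((i,j),k),l). norm (T z i * cnj (T z j) * T z k * cnj (T z l))) has_sum (\<Sum>\<^sub>\<infinity>n. norm (T z n)) ^ 4) UNIV"
    by (simp add: case_prod_unfold norm_mult power4_eq_xxxx power3_eq_cube)
qed

text \<open>The index is nested as ((p, q), m) to match a product of a sum over (p, q) with a sum
  over m, the form in which the eigenvalue factors off.\<close>

definition triple_term :: "complex \<Rightarrow> (int \<times> int) \<times> int \<Rightarrow> complex" where
  "triple_term z = (\<lambda>((p,q),m). T z (m + p) * cnj (T z (m + p + q)) * T z (m + q))"

text \<open>For factors with indices i, j, k, l, the extra variable is the detuning d = j + l - i -
  k. The term oscillates in the real part of \<open>z\<close> with frequency - 2 h d, so only d = 0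
  survives integration over a period.\<close>

definition quadruple_term :: "complex \<Rightarrow> ((int \<times> int) \<times> int) \<times> int \<Rightarrow> complex" where
  "quadruple_term z = (\<lambda>(((p,q),m),d). T z (m + p) * cnj (T z (m + p + q + d)) * T z (m + q) * cnj (T z m))"

definition pair_term :: "complex \<Rightarrow> int \<times> int \<Rightarrow> complex" where
  "pair_term z = (\<lambda>(m,d). T z m * cnj (T z (m + d)))"

lemma pair_term:
  shows "(pair_term z has_sum u z * cnj (u z)) UNIV"
    and "(\<lambda>x. norm (pair_term z x)) summable_on UNIV" "(\<Sum>\<^sub>\<infinity>x. norm (pair_term z x)) \<le> B\<^sup>2"
proof -
  have bij: "bij_betw (\<lambda>(m::int,d). (m, m + d)) UNIV UNIV"
    by (rule bij_betw_byWitness[of _ "\<lambda>(i,j). (i, j - i)"]) auto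
  have eq: "(\<lambda>(i,j). T z i * cnj (T z j)) ((\<lambda>(m,d). (m, m + d)) x) = pair_term z x"
    "(\<lambda>(i,j). norm (T z i * cnj (T z j))) ((\<lambda>(m,d). (m, m + d)) x) = norm (pair_term z x)" for x
    by (auto simp: pair_term_def split: prod.splits)
  show "(pair_term z has_sum u z * cnj (u z)) UNIV"
    using has_sum_reindex_bij_betw[OF bij, of "\<lambda>(i,j). T z i * cnj (T z j)" "u z * cnj (u z)"] theta_pair(1)[of z]
    unfolding eq by simp
  have n: "((\<lambda>x. norm (pair_term z x)) has_sum (\<Sum>\<^sub>\<infinity>n. norm (T z n))\<^sup>2) UNIV"
    using has_sum_reindex_bij_betw[OF bij, of "\<lambda>(i,j). norm (T z i * cnj (T z j))" "(\<Sum>\<^sub>\<infinity>n. norm (T z n))\<^sup>2"] theta_pair(2)[of z]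
    unfolding eq by simp
  then show "(\<lambda>x. norm (pair_term z x)) summable_on UNIV" by (auto simp: summable_on_def)
  show "(\<Sum>\<^sub>\<infinity>x. norm (pair_term z x)) \<le> B\<^sup>2"
    using infsumI[OF n] theta_term_norm_le[of z] theta_term_norm_ge[of z] by (auto intro: power_mono)
qed

lemma triple_term:
  shows "(triple_term z has_sum u z * cnj (u z) * u z) UNIV"
    and "(\<lambda>x. norm (triple_term z x)) summable_on UNIV" "(\<Sum>\<^sub>\<infinity>x. norm (triple_term z x)) \<le> B ^ 3"
proof -
  let ?g = "\<lambda>((p::int,q::int),m::int). ((m + p, m + p + q), m + q)"
  have bij: "bij_betw ?g UNIV UNIV"
    by (rule bij_betw_byWitness[of _ "\<lambda>((i,j),k). ((j - k, j - i), i + k - j)"]) auto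
  have eq: "(\<lambda>((i,j),k). T z i * cnj (T z j) * T z k) (?g x) = triple_term z x"
    "(\<lambda>((i,j),k). norm (T z i * cnj (T z j) * T z k)) (?g x) = norm (triple_term z x)" for x
    by (auto simp: triple_term_def split: prod.splits)
  show "(triple_term z has_sum u z * cnj (u z) * u z) UNIV"
    using has_sum_reindex_bij_betw[OF bij, of "\<lambda>((i,j),k). T z i * cnj (T z j) * T z k"] theta_triple(1)[of z]
    unfolding eq by simp
  have n: "((\<lambda>x. norm (triple_term z x)) has_sum (\<Sum>\<^sub>\<infinity>n. norm (T z n)) ^ 3) UNIV"
    using has_sum_reindex_bij_betw[OF bij, of "\<lambda>((i,j),k). norm (T z i * cnj (T z j) * T z k)"] theta_triple(2)[of z]
    unfolding eq by simp
  then show "(\<lambda>x. norm (triple_term z x)) summable_on UNIV" by (auto simp: summable_on_def)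
  show "(\<Sum>\<^sub>\<infinity>x. norm (triple_term z x)) \<le> B ^ 3"
    using infsumI[OF n] theta_term_norm_le[of z] theta_term_norm_ge[of z] by (auto intro: power_mono)
qed

lemma quadruple_term:
  shows "(quadruple_term z has_sum u z * cnj (u z) * u z * cnj (u z)) UNIV"
    and "(\<lambda>x. norm (quadruple_term z x)) summable_on UNIV" "(\<Sum>\<^sub>\<infinity>x. norm (quadruple_term z x)) \<le> B ^ 4"
proof -
  let ?g = "\<lambda>(((p::int,q::int),m::int),d::int). (((m + p, m + p + q + d), m + q), m)"
  have bij: "bij_betw ?g UNIV UNIV"
    by (rule bij_betw_byWitness[of _ "\<lambda>(((i,j),k),l). (((i - l, k - l), l), j + l - i - k)"]) auto
  have eq: "(\<lambda>(((i,j),k),l). T z i * cnj (T z j) * T z k * cnj (T z l)) (?g x) = quadruple_term z x"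
    "(\<lambda>(((i,j),k),l). norm (T z i * cnj (T z j) * T z k * cnj (T z l))) (?g x) = norm (quadruple_term z x)" for x
    by (auto simp: quadruple_term_def split: prod.splits)
  show "(quadruple_term z has_sum u z * cnj (u z) * u z * cnj (u z)) UNIV"
    using has_sum_reindex_bij_betw[OF bij, of "\<lambda>(((i,j),k),l). T z i * cnj (T z j) * T z k * cnj (T z l)"] theta_quadruple(1)[of z]
    unfolding eq by simp
  have n: "((\<lambda>x. norm (quadruple_term z x)) has_sum (\<Sum>\<^sub>\<infinity>n. norm (T z n)) ^ 4) UNIV"
    using has_sum_reindex_bij_betw[OF bij, of "\<lambda>(((i,j),k),l). norm (T z i * cnj (T z j) * T z k * cnj (T z l))"] theta_quadruple(2)[of z]
    unfolding eq by simp
  then show "(\<lambda>x. norm (quadruple_term z x)) summable_on UNIV" by (auto simp: summable_on_def)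
  show "(\<Sum>\<^sub>\<infinity>x. norm (quadruple_term z x)) \<le> B ^ 4"
    using infsumI[OF n] theta_term_norm_le[of z] theta_term_norm_ge[of z] by (auto intro: power_mono)
qed

lemma borel_measurable_terms [measurable]:
  "(\<lambda>z. pair_term z a) \<in> borel_measurable borel" "(\<lambda>z. triple_term z b) \<in> borel_measurable borel" "(\<lambda>z. quadruple_term z c) \<in> borel_measurable borel"
  unfolding pair_term_def triple_term_def quadruple_term_def case_prod_unfold
  by (intro borel_measurable_continuous_onI continuous_intros)+

end

section \<open>The projector and the cell integrals\<close>

text \<open>Removes the detuning variable once integration in the real direction has annihilated all
  of its values but one.\<close>

lemma has_sum_diagonal:
  fixes f :: "'i \<Rightarrow> 'b::banach" and k :: "'k"
  assumes "((\<lambda>(i,d). if d = k then f i else 0) has_sum S) UNIV"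
  shows "(f has_sum S) UNIV"
proof -
  have "((\<lambda>(i,d). if d = k then f i else 0) has_sum S) (Sigma UNIV (\<lambda>_. UNIV))"
    using assms by simp
  then show ?thesis
    by (rule has_sum_SigmaD) (auto intro!: has_sum_finite_neutralI[of "{k}"] split: if_splits)
qed

section \<open>Slicing the fundamental cell horizontally\<close>

lemma fundamental_cell_image:
  "fundamental_cell \<tau> \<gamma> = (\<lambda>(r1, r2). of_real \<gamma> * (of_real r1 + of_real r2 * \<tau>)) ` ({0..1} \<times> {0..1})"
proof -
  have "{f a b | a b. a \<in> A \<and> b \<in> A} = (\<lambda>(a, b). f a b) ` (A \<times> A)" for f :: "real \<Rightarrow> real \<Rightarrow> complex" and A
    by auto
  then show ?thesis unfolding fundamental_cell_def .
qed

lemma compact_fundamental_cell: "compact (fundamental_cell \<tau> \<gamma>)"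
  unfolding fundamental_cell_image case_prod_unfold
  by (intro compact_continuous_image continuous_intros compact_Times) auto

lemma Complex_in_fundamental_cell:
  assumes \<gamma>: "\<gamma> > 0" and \<tau>: "Im \<tau> > 0"
  shows "Complex x y \<in> fundamental_cell \<tau> \<gamma> \<longleftrightarrow>
    y \<in> {0..\<gamma> * Im \<tau>} \<and> x \<in> {y * Re \<tau> / Im \<tau>..y * Re \<tau> / Im \<tau> + \<gamma>}"
proof
  assume "Complex x y \<in> fundamental_cell \<tau> \<gamma>"
  then obtain r1 r2 where r: "r1 \<in> {0..1}" "r2 \<in> {0..1}"
    and x: "x = \<gamma> * r1 + \<gamma> * r2 * Re \<tau>" and y: "y = \<gamma> * r2 * Im \<tau>"
    by (auto simp: fundamental_cell_def complex_eq_iff algebra_simps)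
  have "y * Re \<tau> / Im \<tau> = \<gamma> * r2 * Re \<tau>" using y \<tau> by simp
  then show "y \<in> {0..\<gamma> * Im \<tau>} \<and> x \<in> {y * Re \<tau> / Im \<tau>..y * Re \<tau> / Im \<tau> + \<gamma>}"
    using r \<gamma> \<tau> by (auto simp: x y mult_left_le)
next
  assume *: "y \<in> {0..\<gamma> * Im \<tau>} \<and> x \<in> {y * Re \<tau> / Im \<tau>..y * Re \<tau> / Im \<tau> + \<gamma>}"
  define r2 r1 where "r2 = y / (\<gamma> * Im \<tau>)" and "r1 = (x - y * Re \<tau> / Im \<tau>) / \<gamma>"
  have "r1 \<in> {0..1}" "r2 \<in> {0..1}"
    using * \<gamma> \<tau> by (auto simp: r1_def r2_def divide_le_eq)
  moreover have "Complex x y = of_real \<gamma> * (of_real r1 + of_real r2 * \<tau>)"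
    using \<gamma> \<tau> by (auto simp: complex_eq_iff r1_def r2_def field_simps)
  ultimately show "Complex x y \<in> fundamental_cell \<tau> \<gamma>"
    unfolding fundamental_cell_def by blast
qed

text \<open>Every horizontal slice is a full period of \<open>cis (2 * h * k * x)\<close>, so its
  starting point, which moves with \<open>y\<close>, drops out and the slant of the cell leaves no
  trace in the integral.\<close>

lemma integral_fundamental_cell:
  fixes G :: "real \<Rightarrow> complex" and k :: int
  assumes h: "h > 0" and \<tau>: "Im \<tau> > 0" and L: "pi / h * Im \<tau> = L" and G: "continuous_on UNIV G"
  shows "(\<integral>z. indicator (fundamental_cell \<tau> (pi / h)) z *\<^sub>R (cis (2 * h * k * Re z) * G (Im z)) \<partial>lborel)
     = (if k = 0 then of_real (pi / h) * (\<integral>y. indicator {0..L} y *\<^sub>R G y \<partial>lborel) else 0)"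
proof -
  let ?K = "fundamental_cell \<tau> (pi / h)"
  let ?s = "\<lambda>y. y * Re \<tau> / Im \<tau>"
  have "integrable lborel (\<lambda>z. indicator ?K z *\<^sub>R (cis (2 * h * k * Re z) * G (Im z)))"
    by (rule borel_integrable_compact[OF compact_fundamental_cell])
       (auto intro!: continuous_intros continuous_on_compose2[OF G])
  then have "(\<integral>z. indicator ?K z *\<^sub>R (cis (2 * h * k * Re z) * G (Im z)) \<partial>lborel)
      = (\<integral>y. (\<integral>x. indicator ?K (Complex x y) *\<^sub>R (cis (2 * h * k * x) * G y) \<partial>lborel) \<partial>lborel)"
    by (subst integral_lborel_complex) auto
  also have "\<dots> = (\<integral>y. (\<integral>x. (indicator {0..L} y *\<^sub>R G y) * (indicator {?s y..?s y + pi / h} x *\<^sub>R cis (2 * h * k * x)) \<partial>lborel) \<partial>lborel)"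
  proof -
    have "indicator ?K (Complex x y) *\<^sub>R (cis (2 * h * k * x) * G y)
       = (indicator {0..L} y *\<^sub>R G y) * (indicator {?s y..?s y + pi / h} x *\<^sub>R cis (2 * h * k * x))" for x y
      using Complex_in_fundamental_cell[of "pi / h" \<tau> x y] h \<tau> L by (auto simp: indicator_def)
    then show ?thesis by simp
  qed
  also have "\<dots> = (\<integral>y. (indicator {0..L} y *\<^sub>R G y) * (if k = 0 then of_real (pi / h) else 0) \<partial>lborel)"
    unfolding integral_mult_right_zero integral_period_cis[OF h] ..
  also have "\<dots> = (if k = 0 then of_real (pi / h) * (\<integral>y. indicator {0..L} y *\<^sub>R G y \<partial>lborel) else 0)"
    unfolding integral_mult_left_zero by simp
  finally show ?thesis .
qed

context gaussian_theta
begin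

text \<open>With every factor a single exponential, product identities are proved by comparing real
  and imaginary parts of exponents, which is polynomial algebra.\<close>

lemma theta_term_exp:
  "T w n = exp (Complex (- (Im w + h * n)\<^sup>2) (\<theta> * (of_int n)\<^sup>2 + \<nu> * n + Re w * Im w + 2 * h * n * Re w))"
proof -
  have *: "cis a * (of_real (exp c) * cis b) = exp (Complex c (a + b))" for a b c
    by (simp add: Complex_eq exp_add exp_of_real cis_conv_exp ring_distribs mult_ac)
  show ?thesis
    unfolding theta_term_def wave_eq *
    by (rule arg_cong[where f = exp]) (simp add: complex_eq_iff algebra_simps)
qed

lemma pair_term_eq:
  "pair_term w (m, d) = cis (2 * h * of_int (- d) * Re w) *
     (cis (\<theta> * ((of_int m)\<^sup>2 - (of_int (m + d))\<^sup>2) - \<nu> * of_int d) *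
      of_real (exp (- (Im w + h * m)\<^sup>2 - (Im w + h * (m + d))\<^sup>2)))"
proof -
  have *: "cis a * (cis b * of_real (exp c)) = exp (Complex c (a + b))" for a b c
    by (simp add: Complex_eq exp_add exp_of_real cis_conv_exp ring_distribs mult_ac)
  show ?thesis
    unfolding pair_term_def prod.case theta_term_exp * exp_cnj exp_add[symmetric]
    by (rule arg_cong[where f = exp]) (simp add: complex_eq_iff algebra_simps)
qed

lemma quadruple_term_eq:
  "quadruple_term w (((p, q), m), d) = cis (2 * h * of_int (- d) * Re w) *
     (cis (\<theta> * ((of_int (m + p))\<^sup>2 - (of_int (m + p + q + d))\<^sup>2 + (of_int (m + q))\<^sup>2 - (of_int m)\<^sup>2) - \<nu> * of_int d) *
      of_real (exp (- (Im w + h * m)\<^sup>2 - (Im w + h * (m + p))\<^sup>2 - (Im w + h * (m + q))\<^sup>2 - (Im w + h * (m + p + q + d))\<^sup>2)))"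
proof -
  have *: "cis a * (cis b * of_real (exp c)) = exp (Complex c (a + b))" for a b c
    by (simp add: Complex_eq exp_add exp_of_real cis_conv_exp ring_distribs mult_ac)
  show ?thesis
    unfolding quadruple_term_def prod.case theta_term_exp * exp_cnj exp_add[symmetric]
    by (rule arg_cong[where f = exp]) (simp add: complex_eq_iff algebra_simps)
qed

text \<open>Isolates the dependence on \<open>x\<close>. As (m + p) - (m + p + q) + (m + q) = m, the
  linear coefficient in \<open>x\<close> involves m but neither p nor q. The squares of the indices
  combine to m^2 - 2 p q, the source of the twist.\<close>

lemma kernel_triple_term_eq:
  "exp (cnj (Complex x y) * z - of_real ((cmod (Complex x y))\<^sup>2) / 2) * triple_term (Complex x y) ((p, q), m)
   = exp (- \<i> * of_real y * z - of_real (y\<^sup>2) / 2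
       + Complex (- (y + h * (m + p))\<^sup>2 - (y + h * (m + q))\<^sup>2 - (y + h * (m + p + q))\<^sup>2)
           (- 2 * \<theta> * p * q + \<theta> * (of_int m)\<^sup>2 + \<nu> * m))
     * exp (- of_real (1/2 * x\<^sup>2) + (z + \<i> * of_real (y + 2 * h * m)) * of_real x)"
  unfolding triple_term_def prod.case theta_term_exp exp_cnj exp_add[symmetric] cmod_power2
  by (rule arg_cong[where f = exp]) (simp add: complex_eq_iff power2_eq_square algebra_simps)

lemma integral_kernel_triple_term:
  "(\<integral>w. exp (cnj w * z - of_real ((cmod w)\<^sup>2) / 2) * triple_term w ((p, q), m) \<partial>lborel)
   = of_real (pi / sqrt 2) * exp (of_real ((cmod z)\<^sup>2) / 2) *
      (cis (- 2 * \<theta> * of_int p * of_int q) * of_real (exp (- (h\<^sup>2 * (of_int p)\<^sup>2) - h\<^sup>2 * (of_int q)\<^sup>2)) * T z m)"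
    (is "integral\<^sup>L _ ?f = _")
proof -
  have "continuous_on UNIV (\<lambda>w. triple_term w ((p, q), m))"
    unfolding triple_term_def prod.case by (intro continuous_intros)
  then have "continuous_on UNIV ?f" by (intro continuous_intros) auto
  then have meas: "?f \<in> borel_measurable borel" by (rule borel_measurable_continuous_onI)
  have term_le: "cmod (triple_term w ((p, q), m)) \<le> 1" for w
    unfolding triple_term_def prod.case norm_mult complex_mod_cnj
    by (intro mult_le_one norm_theta_term_le_1) auto
  have "integrable lborel ?f"
    by (rule Bochner_Integration.integrable_bound[OF integrable_exp_cnj_mult[of z]])
       (use meas in \<open>auto intro!: AE_I2 mult_left_le term_le simp: norm_mult\<close>)
  then have "integral\<^sup>L lborel ?f = (\<integral>y. (\<integral>x. ?f (Complex x y) \<partial>lborel) \<partial>lborel)"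
    by (rule integral_lborel_complex)
  also have "\<dots> = (\<integral>y. of_real (sqrt (2 * pi)) * exp (z\<^sup>2 / 2 + 2 * \<i> * of_real (h * m) * z - of_real ((h * m)\<^sup>2)
        + \<i> * of_real (- 2 * \<theta> * p * q + \<theta> * (of_int m)\<^sup>2 + \<nu> * m)) *
        of_real (exp (- (y + h * m)\<^sup>2 - (y + h * (m + p))\<^sup>2 - (y + h * (m + q))\<^sup>2 - (y + h * (m + p + q))\<^sup>2)) \<partial>lborel)"
  proof (rule arg_cong[where f = "integral\<^sup>L lborel"], rule ext)
    fix y :: real
    let ?F = "exp (- \<i> * of_real y * z - of_real (y\<^sup>2) / 2
       + Complex (- (y + h * (m + p))\<^sup>2 - (y + h * (m + q))\<^sup>2 - (y + h * (m + p + q))\<^sup>2)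
           (- 2 * \<theta> * p * q + \<theta> * (of_int m)\<^sup>2 + \<nu> * m))"
    have "(\<integral>x. ?f (Complex x y) \<partial>lborel) = ?F * (of_real (sqrt (pi / (1/2))) * exp ((z + \<i> * of_real (y + 2 * h * m))\<^sup>2 / of_real (4 * (1/2))))"
      unfolding kernel_triple_term_eq integral_mult_right_zero
      using has_bochner_integral_gaussian[of "1/2" "z + \<i> * of_real (y + 2 * h * m)"]
      by (simp only: has_bochner_integral_iff)
    also have "\<dots> = of_real (sqrt (2 * pi)) * (?F * exp ((z + \<i> * of_real (y + 2 * h * m))\<^sup>2 / 2))"
      by (simp add: mult.commute mult.left_commute)
    \<comment> \<open>The exponents - y^2 / 2 of the kernel and - (y + 2 h m)^2 / 2 of the
      \<open>x\<close>-integral add up to - (y + h m)^2 - (h m)^2: this is the fourth Gaussian. The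
      mixed terms in y z cancel, so the remaining integral over \<open>y\<close> does not involve
      \<open>z\<close>.\<close>
    also have "?F * exp ((z + \<i> * of_real (y + 2 * h * m))\<^sup>2 / 2)
        = exp (z\<^sup>2 / 2 + 2 * \<i> * of_real (h * m) * z - of_real ((h * m)\<^sup>2)
        + \<i> * of_real (- 2 * \<theta> * p * q + \<theta> * (of_int m)\<^sup>2 + \<nu> * m)) *
        of_real (exp (- (y + h * m)\<^sup>2 - (y + h * (m + p))\<^sup>2 - (y + h * (m + q))\<^sup>2 - (y + h * (m + p + q))\<^sup>2))"
      unfolding exp_of_real[symmetric] exp_add[symmetric]
      by (rule arg_cong[where f = exp]) (simp add: complex_eq_iff power2_eq_square field_simps)
    finally show "(\<integral>x. ?f (Complex x y) \<partial>lborel) = of_real (sqrt (2 * pi)) * exp (z\<^sup>2 / 2 + 2 * \<i> * of_real (h * m) * z - of_real ((h * m)\<^sup>2)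
        + \<i> * of_real (- 2 * \<theta> * p * q + \<theta> * (of_int m)\<^sup>2 + \<nu> * m)) *
        of_real (exp (- (y + h * m)\<^sup>2 - (y + h * (m + p))\<^sup>2 - (y + h * (m + q))\<^sup>2 - (y + h * (m + p + q))\<^sup>2))"
      by (simp only: mult.assoc)
  qed
  also have "\<dots> = of_real (sqrt (2 * pi)) * exp (z\<^sup>2 / 2 + 2 * \<i> * of_real (h * m) * z - of_real ((h * m)\<^sup>2)
        + \<i> * of_real (- 2 * \<theta> * p * q + \<theta> * (of_int m)\<^sup>2 + \<nu> * m)) *
        of_real (sqrt pi / 2 * exp (- (h\<^sup>2 * (of_int p)\<^sup>2) - h\<^sup>2 * (of_int q)\<^sup>2))"
    unfolding integral_mult_right_zero
    using gaussian_quad_sum[of h m p q] by (simp only: has_bochner_integral_iff)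
  also have "exp (z\<^sup>2 / 2 + 2 * \<i> * of_real (h * m) * z - of_real ((h * m)\<^sup>2)
        + \<i> * of_real (- 2 * \<theta> * p * q + \<theta> * (of_int m)\<^sup>2 + \<nu> * m))
      = exp (of_real ((cmod z)\<^sup>2) / 2) * (cis (- 2 * \<theta> * of_int p * of_int q) * T z m)"
    unfolding theta_term_def wave_def cis_conv_exp exp_add[symmetric]
    by (rule arg_cong[where f = exp]) (simp add: algebra_simps)
  also have "of_real (sqrt (2 * pi)) * (exp (of_real ((cmod z)\<^sup>2) / 2) * (cis (- 2 * \<theta> * of_int p * of_int q) * T z m)) *
        of_real (sqrt pi / 2 * exp (- (h\<^sup>2 * (of_int p)\<^sup>2) - h\<^sup>2 * (of_int q)\<^sup>2))
      = of_real (sqrt (2 * pi) * (sqrt pi / 2)) * exp (of_real ((cmod z)\<^sup>2) / 2) *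
      (cis (- 2 * \<theta> * of_int p * of_int q) * of_real (exp (- (h\<^sup>2 * (of_int p)\<^sup>2) - h\<^sup>2 * (of_int q)\<^sup>2)) * T z m)"
    by (simp add: mult_ac)
  \<comment> \<open>The factor pi cancels the 1 / pi in the definition of the projector; 1 / sqrt 2
    remains in the eigenvalue.\<close>
  also have "sqrt (2 * pi) * (sqrt pi / 2) = pi / sqrt 2"
    by (simp add: real_sqrt_mult field_simps)
  finally show ?thesis .
qed

lemma LLL_proj_theta:
  "LLL_proj (\<lambda>w. of_real ((cmod (u w))\<^sup>2) * u w) z = twisted_sum h \<theta> / of_real (sqrt 2) * u z"
proof -
  let ?k = "\<lambda>w. exp (cnj w * z - of_real ((cmod w)\<^sup>2) / 2)"
  let ?b = "\<lambda>(p::int, q::int). cis (- 2 * \<theta> * of_int p * of_int q) * of_real (exp (- (h\<^sup>2 * (of_int p)\<^sup>2) - h\<^sup>2 * (of_int q)\<^sup>2))"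
  have k: "?k \<in> borel_measurable borel"
    by (intro borel_measurable_continuous_onI continuous_intros) auto
  have kt: "(\<lambda>w. ?k w * triple_term w i) \<in> borel_measurable borel" for i
    by (intro borel_measurable_times k borel_measurable_terms)
  have uu: "of_real ((cmod (u w))\<^sup>2) * u w = u w * cnj (u w) * u w" for w
    by (simp only: complex_norm_square)
  have "((\<lambda>i. \<integral>w. ?k w * triple_term w i \<partial>lborel) has_sum (\<integral>w. (\<Sum>\<^sub>\<infinity>i. ?k w * triple_term w i) \<partial>lborel)) UNIV"
  proof (rule has_sum_integral[where g = "\<lambda>w. cmod (?k w) * B ^ 3"])
    show "(\<lambda>i. norm (?k w * triple_term w i)) summable_on UNIV" for w
      unfolding norm_mult by (intro summable_on_cmult_right triple_term)
    show "(\<Sum>\<^sub>\<infinity>i. norm (?k w * triple_term w i)) \<le> cmod (?k w) * B ^ 3" for w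
      unfolding norm_mult infsum_cmult_right' by (intro mult_left_mono triple_term) auto
    show "(\<lambda>w. ?k w * triple_term w i) \<in> borel_measurable lborel" for i
      using kt by simp
    show "integrable lborel (\<lambda>w. cmod (?k w) * B ^ 3)"
      by (intro integrable_mult_left integrable_exp_cnj_mult)
  qed (simp add: infinite_UNIV_int finite_prod)
  moreover have "(\<Sum>\<^sub>\<infinity>i. ?k w * triple_term w i) = ?k w * (of_real ((cmod (u w))\<^sup>2) * u w)" for w
    unfolding uu infsum_cmult_right' using infsumI[OF triple_term(1)[of w]] by simp
  moreover have "(\<lambda>i. \<integral>w. ?k w * triple_term w i \<partial>lborel)
      = (\<lambda>i. of_real (pi / sqrt 2) * exp (of_real ((cmod z)\<^sup>2) / 2) * ((\<lambda>(x,m). ?b x * T z m) i))"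
  proof (rule ext)
    fix i :: "(int \<times> int) \<times> int"
    obtain p q m where i: "i = ((p, q), m)" by (metis surj_pair)
    show "(\<integral>w. ?k w * triple_term w i \<partial>lborel)
      = of_real (pi / sqrt 2) * exp (of_real ((cmod z)\<^sup>2) / 2) * ((\<lambda>(x,m). ?b x * T z m) i)"
      unfolding i prod.case by (rule integral_kernel_triple_term)
  qed
  ultimately have "((\<lambda>i. of_real (pi / sqrt 2) * exp (of_real ((cmod z)\<^sup>2) / 2) * ((\<lambda>(x,m). ?b x * T z m) i))
      has_sum (\<integral>w. ?k w * (of_real ((cmod (u w))\<^sup>2) * u w) \<partial>lborel)) UNIV"
    by simp
  moreover have "((\<lambda>(x,m). ?b x * T z m) has_sum twisted_sum h \<theta> * u z) UNIV"
    using has_sum_times(1)[OF twisted_sum_abs_summable[OF h, of \<theta>] theta_term_summable[of z]]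
    by (simp add: twisted_sum_def theta_sum_def)
  then have "((\<lambda>i. of_real (pi / sqrt 2) * exp (of_real ((cmod z)\<^sup>2) / 2) * ((\<lambda>(x,m). ?b x * T z m) i))
      has_sum of_real (pi / sqrt 2) * exp (of_real ((cmod z)\<^sup>2) / 2) * (twisted_sum h \<theta> * u z)) UNIV"
    by (rule has_sum_cmult_right)
  ultimately have *: "(\<integral>w. ?k w * (of_real ((cmod (u w))\<^sup>2) * u w) \<partial>lborel)
      = of_real (pi / sqrt 2) * exp (of_real ((cmod z)\<^sup>2) / 2) * (twisted_sum h \<theta> * u z)"
    by (rule has_sum_unique)
  \<comment> \<open>The projector integrates over the completed measure; for a Borel integrand this
    changes nothing.\<close>
  have "(\<integral>w. ?k w * (of_real ((cmod (u w))\<^sup>2) * u w) \<partial>lebesgue) = (\<integral>w. ?k w * (of_real ((cmod (u w))\<^sup>2) * u w) \<partial>lborel)"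
  proof (rule integral_completion)
    have "(\<lambda>w. ?k w * (of_real ((cmod (u w))\<^sup>2) * u w)) \<in> borel_measurable borel"
    proof (intro borel_measurable_times k borel_measurable_theta_sum)
      show "(\<lambda>w. complex_of_real ((cmod (u w))\<^sup>2)) \<in> borel_measurable borel"
        by measurable
    qed
    then show "(\<lambda>w. ?k w * (of_real ((cmod (u w))\<^sup>2) * u w)) \<in> borel_measurable lborel"
      by simp
  qed
  then show ?thesis
    unfolding LLL_proj_def * by (simp add: exp_minus field_simps)
qed

text \<open>For d = 0 the phases cancel completely, and the height \<open>h * real N\<close> of the
  cell unfolds the Gaussians exp (- 2 (y + h m)^2) to \<open>N\<close> copies of one integral over
  the line.\<close>

lemma integral_cell_sq:
  assumes \<tau>: "Im \<tau> > 0" "pi / h * Im \<tau> = h * real N"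
  shows "(\<integral>z. indicator (fundamental_cell \<tau> (pi / h)) z *\<^sub>R (u z * cnj (u z)) \<partial>lborel)
      = of_real (pi / h * (real N * sqrt (pi / 2)))"
proof -
  let ?K = "fundamental_cell \<tau> (pi / h)"
  define A where "A m = (\<integral>y. indicator {0..h * real N} y *\<^sub>R (of_real (exp (- (2 * (y + h * of_int m)\<^sup>2))) :: complex) \<partial>lborel)" for m :: int
  have [measurable]: "?K \<in> sets borel"
    using compact_fundamental_cell by (intro borel_closed compact_imp_closed)
  have "((\<lambda>i. \<integral>z. indicator ?K z *\<^sub>R pair_term z i \<partial>lborel) has_sum (\<integral>z. (\<Sum>\<^sub>\<infinity>i. indicator ?K z *\<^sub>R pair_term z i) \<partial>lborel)) UNIV"
  proof (rule has_sum_integral[where g = "\<lambda>z. indicator ?K z *\<^sub>R B\<^sup>2"])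
    have n: "norm (indicator ?K z *\<^sub>R pair_term z i) = indicator ?K z * norm (pair_term z i)" for z i by simp
    show "(\<lambda>i. norm (indicator ?K z *\<^sub>R pair_term z i)) summable_on UNIV" for z
      unfolding n by (intro summable_on_cmult_right pair_term)
    show "(\<Sum>\<^sub>\<infinity>i. norm (indicator ?K z *\<^sub>R pair_term z i)) \<le> indicator ?K z *\<^sub>R B\<^sup>2" for z
      unfolding n infsum_cmult_right' real_scaleR_def by (intro mult_left_mono pair_term) auto
    show "integrable lborel (\<lambda>z. indicator ?K z *\<^sub>R B\<^sup>2)"
      by (rule borel_integrable_compact[OF compact_fundamental_cell]) auto
  qed (auto simp: infinite_UNIV_int finite_prod)
  moreover have "(\<Sum>\<^sub>\<infinity>i. indicator ?K z *\<^sub>R pair_term z i) = indicator ?K z *\<^sub>R (u z * cnj (u z))" for z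
    unfolding infsum_scaleR_right using infsumI[OF pair_term(1)[of z]] by simp
  moreover have "(\<lambda>i. \<integral>z. indicator ?K z *\<^sub>R pair_term z i \<partial>lborel) = (\<lambda>(m, d). if d = 0 then of_real (pi / h) * A m else 0)"
  proof (rule ext)
    fix i :: "int \<times> int"
    obtain m d where i: "i = (m, d)" by (cases i)
    have "(\<integral>z. indicator ?K z *\<^sub>R pair_term z (m, d) \<partial>lborel) = (if d = 0 then of_real (pi / h) * A m else 0)"
      unfolding pair_term_eq
      by (subst integral_fundamental_cell[OF h \<tau>, where G = "\<lambda>y. cis (\<theta> * ((of_int m)\<^sup>2 - (of_int (m + d))\<^sup>2) - \<nu> * of_int d) *
      of_real (exp (- (y + h * m)\<^sup>2 - (y + h * (m + d))\<^sup>2))"])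
         (auto intro!: continuous_intros simp: A_def)
    then show "(\<integral>z. indicator ?K z *\<^sub>R pair_term z i \<partial>lborel) = (\<lambda>(m, d). if d = 0 then of_real (pi / h) * A m else 0) i"
      unfolding i by simp
  qed
  ultimately have "((\<lambda>(m, d::int). if d = 0 then of_real (pi / h) * A m else 0) has_sum
      (\<integral>z. indicator ?K z *\<^sub>R (u z * cnj (u z)) \<partial>lborel)) UNIV"
    by simp
  then have "((\<lambda>m. of_real (pi / h) * A m) has_sum (\<integral>z. indicator ?K z *\<^sub>R (u z * cnj (u z)) \<partial>lborel)) UNIV"
    by (rule has_sum_diagonal)
  moreover have "((\<lambda>m. of_real (pi / h) * A m) has_sum of_real (pi / h) * (of_nat N * of_real (sqrt (pi / 2)))) UNIV"
  proof (rule has_sum_cmult_right)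
    have "has_bochner_integral lborel (\<lambda>y::real. of_real (exp (- (2 * y\<^sup>2)))) (of_real (sqrt (pi / 2)) :: complex)"
      using has_bochner_integral_gaussian[of 2 0] by (simp add: exp_of_real[symmetric])
    then show "(A has_sum of_nat N * of_real (sqrt (pi / 2))) UNIV"
      using has_sum_periodization[of "\<lambda>y. of_real (exp (- (2 * y\<^sup>2)))" h N] h
      by (simp add: A_def[abs_def] has_bochner_integral_iff)
  qed
  ultimately have "(\<integral>z. indicator ?K z *\<^sub>R (u z * cnj (u z)) \<partial>lborel) = of_real (pi / h) * (of_nat N * of_real (sqrt (pi / 2)))"
    by (rule has_sum_unique)
  then show ?thesis by simp
qed

text \<open>The resonant terms carry the same twist and the same four Gaussians as in the projector.
  Here the sum over \<open>m\<close> is consumed in unfolding the window in \<open>y\<close>,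
  whereas there it rebuilt \<open>u\<close>.\<close>

lemma integral_cell_quartic:
  assumes \<tau>: "Im \<tau> > 0" "pi / h * Im \<tau> = h * real N"
  shows "(\<integral>z. indicator (fundamental_cell \<tau> (pi / h)) z *\<^sub>R (u z * cnj (u z) * u z * cnj (u z)) \<partial>lborel)
      = of_real (pi / h * (real N * (sqrt pi / 2))) * twisted_sum h \<theta>"
proof -
  let ?K = "fundamental_cell \<tau> (pi / h)"
  define g where "g p q y = (of_real (exp (- y\<^sup>2 - (y + h * of_int p)\<^sup>2 - (y + h * of_int q)\<^sup>2 - (y + h * of_int (p + q))\<^sup>2)) :: complex)"
    for p q :: int and y :: real
  define A where "A p q m = (\<integral>y. indicator {0..h * real N} y *\<^sub>R g p q (y + h * of_int m) \<partial>lborel)" for p q m :: int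
  let ?c = "\<lambda>p q::int. cis (- 2 * \<theta> * of_int p * of_int q)"
  let ?e = "\<lambda>p q::int. exp (- (h\<^sup>2 * (of_int p)\<^sup>2) - h\<^sup>2 * (of_int q)\<^sup>2)"
  have [measurable]: "?K \<in> sets borel"
    using compact_fundamental_cell by (intro borel_closed compact_imp_closed)
  let ?I = "\<integral>z. indicator ?K z *\<^sub>R (u z * cnj (u z) * u z * cnj (u z)) \<partial>lborel"
  have "((\<lambda>i. \<integral>z. indicator ?K z *\<^sub>R quadruple_term z i \<partial>lborel) has_sum (\<integral>z. (\<Sum>\<^sub>\<infinity>i. indicator ?K z *\<^sub>R quadruple_term z i) \<partial>lborel)) UNIV"
  proof (rule has_sum_integral[where g = "\<lambda>z. indicator ?K z *\<^sub>R B ^ 4"])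
    have n: "norm (indicator ?K z *\<^sub>R quadruple_term z i) = indicator ?K z * norm (quadruple_term z i)" for z i by simp
    show "(\<lambda>i. norm (indicator ?K z *\<^sub>R quadruple_term z i)) summable_on UNIV" for z
      unfolding n by (intro summable_on_cmult_right quadruple_term)
    show "(\<Sum>\<^sub>\<infinity>i. norm (indicator ?K z *\<^sub>R quadruple_term z i)) \<le> indicator ?K z *\<^sub>R B ^ 4" for z
      unfolding n infsum_cmult_right' real_scaleR_def by (intro mult_left_mono quadruple_term) auto
    show "integrable lborel (\<lambda>z. indicator ?K z *\<^sub>R B ^ 4)"
      by (rule borel_integrable_compact[OF compact_fundamental_cell]) auto
  qed (auto simp: infinite_UNIV_int finite_prod)
  moreover have "(\<Sum>\<^sub>\<infinity>i. indicator ?K z *\<^sub>R quadruple_term z i) = indicator ?K z *\<^sub>R (u z * cnj (u z) * u z * cnj (u z))" for z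
    unfolding infsum_scaleR_right using infsumI[OF quadruple_term(1)[of z]] by simp
  moreover have "(\<lambda>i. \<integral>z. indicator ?K z *\<^sub>R quadruple_term z i \<partial>lborel)
      = (\<lambda>(i, d). if d = 0 then (\<lambda>((p,q),m). of_real (pi / h) * (?c p q * A p q m)) i else 0)"
  proof (rule ext)
    fix i :: "((int \<times> int) \<times> int) \<times> int"
    obtain p q m d where i: "i = (((p, q), m), d)" by (metis surj_pair)
    define C where "C = cis (\<theta> * ((of_int (m + p))\<^sup>2 - (of_int (m + p + q + d))\<^sup>2 + (of_int (m + q))\<^sup>2 - (of_int m)\<^sup>2) - \<nu> * of_int d)"
    \<comment> \<open>Resonance gives (m + p)^2 - (m + p + q)^2 + (m + q)^2 - m^2 = - 2 p q, free of
      \<open>m\<close>, and removes the linear phase.\<close>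
    have C: "C = ?c p q" if "d = 0"
      unfolding C_def that by (rule arg_cong[where f = cis]) (simp add: power2_eq_square algebra_simps)
    have g: "g p q (y + h * m) = of_real (exp (- (y + h * m)\<^sup>2 - (y + h * (m + p))\<^sup>2 - (y + h * (m + q))\<^sup>2 - (y + h * (m + p + q))\<^sup>2))" for y
      by (simp add: g_def algebra_simps)
    have "(\<integral>z. indicator ?K z *\<^sub>R quadruple_term z (((p, q), m), d) \<partial>lborel)
        = (if - d = 0 then of_real (pi / h) * (\<integral>y. indicator {0..h * real N} y *\<^sub>R (C *
      of_real (exp (- (y + h * m)\<^sup>2 - (y + h * (m + p))\<^sup>2 - (y + h * (m + q))\<^sup>2 - (y + h * (m + p + q + d))\<^sup>2))) \<partial>lborel) else 0)"
      unfolding quadruple_term_eq C_def[symmetric]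
      by (rule integral_fundamental_cell[OF h \<tau>, where G = "\<lambda>y. C *
      of_real (exp (- (y + h * m)\<^sup>2 - (y + h * (m + p))\<^sup>2 - (y + h * (m + q))\<^sup>2 - (y + h * (m + p + q + d))\<^sup>2))"])
         (auto intro!: continuous_intros)
    also have "\<dots> = (if d = 0 then of_real (pi / h) * (?c p q * A p q m) else 0)"
    proof (cases "d = 0")
      case True
      have "(\<integral>y. indicator {0..h * real N} y *\<^sub>R (C *
          of_real (exp (- (y + h * m)\<^sup>2 - (y + h * (m + p))\<^sup>2 - (y + h * (m + q))\<^sup>2 - (y + h * (m + p + q + d))\<^sup>2))) \<partial>lborel)
          = (\<integral>y. C * (indicator {0..h * real N} y *\<^sub>R g p q (y + h * m)) \<partial>lborel)"
        unfolding g True by (simp add: mult_scaleR_right)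
      also have "\<dots> = ?c p q * A p q m"
        unfolding A_def integral_mult_right_zero C[OF True] ..
      finally show ?thesis using True by simp
    qed simp
    finally show "(\<integral>z. indicator ?K z *\<^sub>R quadruple_term z i \<partial>lborel) =
       (\<lambda>(i, d). if d = 0 then (\<lambda>((p,q),m). of_real (pi / h) * (?c p q * A p q m)) i else 0) i"
      unfolding i by simp
  qed
  ultimately have "((\<lambda>(i, d::int). if d = 0 then (\<lambda>((p,q),m). of_real (pi / h) * (?c p q * A p q m)) i else 0) has_sum ?I) UNIV"
    by simp
  then have "((\<lambda>((p,q),m). of_real (pi / h) * (?c p q * A p q m)) has_sum ?I) UNIV"
    by (rule has_sum_diagonal)
  then have "((\<lambda>((p,q),m). of_real (pi / h) * (?c p q * A p q m)) has_sum ?I) (Sigma UNIV (\<lambda>_. UNIV))"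
    by (simp only: UNIV_Times_UNIV)
  then have "((\<lambda>(p,q). of_real (pi / h) * (?c p q * (of_nat N * of_real (sqrt pi / 2 * ?e p q)))) has_sum ?I) UNIV"
  proof (rule has_sum_SigmaD)
    fix x :: "int \<times> int"
    obtain p q where x: "x = (p, q)" by (cases x)
    have "has_bochner_integral lborel (g p q) (of_real (sqrt pi / 2 * ?e p q))"
      using gaussian_quad_sum[of h 0 p q] by (simp add: g_def[abs_def])
    then have int: "integrable lborel (g p q)" and val: "integral\<^sup>L lborel (g p q) = of_real (sqrt pi / 2 * ?e p q)"
      by (simp_all only: has_bochner_integral_iff)
    have "(A p q has_sum of_nat N * of_real (sqrt pi / 2 * ?e p q)) UNIV"
      using has_sum_periodization[OF int h, of N] unfolding val A_def[abs_def] .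
    then show "((\<lambda>m. (\<lambda>((p,q),m). of_real (pi / h) * (?c p q * A p q m)) (x, m)) has_sum
       (\<lambda>(p,q). of_real (pi / h) * (?c p q * (of_nat N * of_real (sqrt pi / 2 * ?e p q)))) x) UNIV"
      unfolding x prod.case by (intro has_sum_cmult_right)
  qed
  moreover have "((\<lambda>x. of_real (pi / h * (real N * (sqrt pi / 2))) * (\<lambda>(p,q). ?c p q * of_real (?e p q)) x) has_sum
      of_real (pi / h * (real N * (sqrt pi / 2))) * twisted_sum h \<theta>) UNIV"
    unfolding twisted_sum_def
    by (rule has_sum_cmult_right[OF has_sum_infsum[OF abs_summable_summable[OF twisted_sum_abs_summable[OF h]]]])
  moreover have "(\<lambda>x. of_real (pi / h * (real N * (sqrt pi / 2))) * (\<lambda>(p,q). ?c p q * of_real (?e p q)) x)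
     = (\<lambda>(p,q). of_real (pi / h) * (?c p q * (of_nat N * of_real (sqrt pi / 2 * ?e p q))))"
    by (simp add: fun_eq_iff)
  ultimately show ?thesis
    by (simp only: has_sum_unique)
qed

end

section \<open>Evaluation of the twisted sum\<close>

lemma minus_one_power_int: "(-1 :: complex) powi n = exp (- (\<i> * of_real pi * of_int n))"
proof -
  have *: "exp (- (\<i> * of_real pi * of_nat k)) = (-1) ^ k" for k
  proof -
    have "exp (- (\<i> * of_real pi * of_nat k)) = exp (of_nat k * (- (\<i> * of_real pi)))" by (simp add: mult_ac)
    also have "\<dots> = (-1) ^ k" unfolding exp_of_nat_mult by (simp add: exp_minus)
    finally show ?thesis .
  qed
  show ?thesis
  proof (cases n)
    case (nonneg k)
    then show ?thesis using *[of k] by simp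
  next
    case (neg k)
    have "exp (\<i> * of_real pi * of_nat (Suc k)) = inverse (exp (- (\<i> * of_real pi * of_nat (Suc k))))"
      by (simp add: exp_minus)
    also have "\<dots> = inverse ((-1) ^ Suc k)" by (simp only: *)
    finally show ?thesis using neg by (simp add: power_int_minus del: of_nat_Suc)
  qed
qed

text \<open>\<open>zb\<close> stands for the conjugate of \<open>z\<close>, so that only field
  algebra is left. The constants of \<open>Phi_0\<close> are tuned to this identity: with z_0 = g /
  2 (\<sigma> - 1), the part - g / 2 cancels the signs (-1)^n and the factor -\<i>, and the part g
  \<sigma> / 2 turns (n + 1/2)^2 into n^2 - 1/4. The term - \<i> pi z / g lowers 2 n + 1 to 2 n. The
  magnetic phase compensates the effect of the translation on z^2 / 2 - |z|^2 / 2 and leaves only a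
  phase linear in n.\<close>

lemma Phi_exponent:
  fixes a g n z zb \<sigma> :: complex
  assumes "g \<noteq> 0"
  shows "(a * zb - a * z) / 2 + (((z + a)\<^sup>2 / 2 - \<i> * of_real pi / g * (z + a) - (z + a) * (zb + a) / 2) + (- (\<i> * of_real pi / 2)
      + (- (\<i> * of_real pi * n) + (\<i> * of_real pi * \<sigma> * (n + 1 / 2)\<^sup>2 + \<i> * (2 * n + 1) * of_real pi * ((z + a - g / 2 * (\<sigma> - 1)) / g)))))
    = - \<i> * of_real pi * \<sigma> / 4 + (\<i> * of_real pi * \<sigma> * n\<^sup>2 + 2 * \<i> * of_real pi * n * (a / g) + (z\<^sup>2 / 2 - z * zb / 2 + 2 * \<i> * (of_real pi / g * n) * z))"
  using assms by (simp add: field_simps power2_eq_square)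

lemma Phi_eq_theta_sum:
  fixes \<gamma> :: real
  assumes N: "N \<ge> 1" and \<gamma>: "\<gamma> > 0" and \<tau>: "\<gamma>\<^sup>2 * Im \<tau> = pi * real N"
  shows "Phi N \<gamma> \<tau> k z = exp (- \<i> * of_real pi * (\<tau> / of_nat N) / 4) *
    theta_sum (pi / \<gamma>) (pi * Re \<tau> / real N) (2 * pi * real k / real N) z"
proof -
  define \<sigma> where "\<sigma> = \<tau> / of_nat N"
  define \<alpha> where "\<alpha> = real k * \<gamma> / real N"
  let ?a = "complex_of_real \<alpha>" and ?g = "complex_of_real \<gamma>"
  let ?P = "exp ((?a * cnj z - cnj ?a * z) / 2)"
  let ?Q = "exp ((z + ?a)\<^sup>2 / 2 - \<i> * of_real pi / ?g * (z + ?a) - of_real ((cmod (z + ?a))\<^sup>2) / 2)"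
  let ?\<zeta> = "(z + ?a - ?g / 2 * (\<sigma> - 1)) / ?g"
  let ?E = "\<lambda>n::int. exp (\<i> * of_real pi * \<sigma> * (of_int n + 1/2)\<^sup>2 + \<i> * of_int (2 * n + 1) * of_real pi * ?\<zeta>)"
  let ?c = "exp (- \<i> * of_real pi * \<sigma> / 4)"
  have g: "?g \<noteq> 0" using \<gamma> by simp
  have ag: "?a / ?g = of_real (real k / real N)"
    using \<gamma> by (simp add: \<alpha>_def)
  have Im\<sigma>: "Im \<sigma> = pi / \<gamma>\<^sup>2"
  proof -
    have "Im \<tau> = pi * real N / \<gamma>\<^sup>2" using \<tau> \<gamma> by (simp add: field_simps)
    then show ?thesis using N by (simp add: \<sigma>_def)
  qed
  have \<sigma>: "\<sigma> = of_real (Re \<tau> / real N) + \<i> * of_real (pi / \<gamma>\<^sup>2)"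
    using Im\<sigma> by (simp add: complex_eq_iff \<sigma>_def)
  have summand: "?P * (?Q * (- \<i> * ((-1) powi n * ?E n))) = ?c * theta_term (pi / \<gamma>) (pi * Re \<tau> / real N) (2 * pi * real k / real N) z n" for n
  proof -
    have i: "- \<i> = exp (- (\<i> * of_real pi / 2))"
      by (simp add: complex_eq_iff Re_exp Im_exp)
    have n: "of_real ((cmod (z + ?a))\<^sup>2) = (z + ?a) * (cnj z + ?a)"
      unfolding complex_norm_square by simp
    have z: "of_real ((cmod z)\<^sup>2) = z * cnj z"
      by (rule complex_norm_square)
    have nn: "of_int (2 * n + 1) = (2 * of_int n + 1 :: complex)" by simp
    have "?P * (?Q * (- \<i> * ((-1) powi n * ?E n)))
      = exp (- \<i> * of_real pi * \<sigma> / 4 + (\<i> * of_real pi * \<sigma> * (of_int n)\<^sup>2 + 2 * \<i> * of_real pi * of_int n * (?a / ?g)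
          + (z\<^sup>2 / 2 - z * cnj z / 2 + 2 * \<i> * (of_real pi / ?g * of_int n) * z)))"
      unfolding i minus_one_power_int n nn complex_cnj_complex_of_real exp_add[symmetric] Phi_exponent[OF g, of ?a "cnj z" z "of_int n" \<sigma>] ..
    also have "\<i> * of_real pi * \<sigma> * (of_int n)\<^sup>2 + 2 * \<i> * of_real pi * of_int n * (?a / ?g)
          + (z\<^sup>2 / 2 - z * cnj z / 2 + 2 * \<i> * (of_real pi / ?g * of_int n) * z)
      = \<i> * of_real (pi * Re \<tau> / real N * (of_int n)\<^sup>2 + 2 * pi * real k / real N * of_int n)
          + (z\<^sup>2 / 2 - of_real ((cmod z)\<^sup>2) / 2 + 2 * \<i> * of_real (pi / \<gamma> * n) * z - of_real ((pi / \<gamma> * n)\<^sup>2))"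
    proof -
      \<comment> \<open>The imaginary part pi / \<gamma>^2 of \<sigma>, fixed by the condition on
        the area of the cell, supplies exactly the decay - (h n)^2 of \<open>wave\<close>.\<close>
      have "\<i> * of_real pi * \<sigma> * (of_int n)\<^sup>2 = \<i> * of_real (pi * Re \<tau> / real N * (of_int n)\<^sup>2) - of_real ((pi / \<gamma> * n)\<^sup>2)"
        unfolding \<sigma> using \<gamma> by (simp add: field_simps power2_eq_square)
      then show ?thesis unfolding ag z by (simp add: algebra_simps)
    qed
    finally show ?thesis
      unfolding theta_term_def wave_def cis_conv_exp exp_add[symmetric] .
  qed
  have "Phi N \<gamma> \<tau> k z = ?P * (?Q * (- \<i> * (\<Sum>\<^sub>\<infinity>n. (-1) powi n * ?E n)))"
    by (simp only: Phi_def magnetic_translation_def Phi_0_def Theta_def Let_def \<sigma>_def \<alpha>_def)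
  also have "\<dots> = (\<Sum>\<^sub>\<infinity>n. ?P * (?Q * (- \<i> * ((-1) powi n * ?E n))))"
    by (simp only: infsum_cmult_right')
  also have "\<dots> = ?c * theta_sum (pi / \<gamma>) (pi * Re \<tau> / real N) (2 * pi * real k / real N) z"
    unfolding theta_sum_def summand infsum_cmult_right' ..
  finally show ?thesis unfolding \<sigma>_def .
qed

text \<open>Row by row evaluation of the double sum: the general formula and both special lattices
  differ only in the row sums \<open>f\<close>.\<close>

lemma has_sum_twisted_sum:
  assumes h: "h > 0"
    and f: "\<And>p::int. ((\<lambda>q::int. of_real (exp (- (h\<^sup>2 * (of_int q)\<^sup>2))) * cis (- 2 * \<theta> * of_int p * of_int q)) has_sum f p) UNIV"
  shows "((\<lambda>p::int. of_real (exp (- (h\<^sup>2 * (of_int p)\<^sup>2))) * f p) has_sum twisted_sum h \<theta>) UNIV"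
proof -
  let ?t = "\<lambda>(p::int, q::int). cis (- 2 * \<theta> * of_int p * of_int q) * of_real (exp (- (h\<^sup>2 * (of_int p)\<^sup>2) - h\<^sup>2 * (of_int q)\<^sup>2))"
  have "(?t has_sum twisted_sum h \<theta>) (Sigma UNIV (\<lambda>_. UNIV))"
    unfolding twisted_sum_def
    using has_sum_infsum[OF abs_summable_summable[OF twisted_sum_abs_summable[OF h]]] by simp
  then show ?thesis
  proof (rule has_sum_SigmaD)
    fix p :: int
    have "((\<lambda>q. of_real (exp (- (h\<^sup>2 * (of_int p)\<^sup>2))) * (of_real (exp (- (h\<^sup>2 * (of_int q)\<^sup>2))) * cis (- 2 * \<theta> * of_int p * of_int q)))
        has_sum of_real (exp (- (h\<^sup>2 * (of_int p)\<^sup>2))) * f p) UNIV"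
      by (rule has_sum_cmult_right[OF f])
    moreover have "of_real (exp (- (h\<^sup>2 * (of_int p)\<^sup>2))) * (of_real (exp (- (h\<^sup>2 * (of_int q)\<^sup>2))) * cis (- 2 * \<theta> * of_int p * of_int q))
       = ?t (p, q)" for q :: int
    proof -
      have "exp (- (h\<^sup>2 * (of_int p)\<^sup>2) - h\<^sup>2 * (of_int q)\<^sup>2) = exp (- (h\<^sup>2 * (of_int p)\<^sup>2)) * exp (- (h\<^sup>2 * (of_int q)\<^sup>2))"
        by (simp add: exp_add[symmetric])
      then show ?thesis by simp
    qed
    ultimately show "((\<lambda>q. ?t (p, q)) has_sum of_real (exp (- (h\<^sup>2 * (of_int p)\<^sup>2))) * f p) UNIV"
      by (simp only:)
  qed
qed

text \<open>In \<open>q\<close> the twist is a character of frequency - \<theta> p / pi, so Poisson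
  summation turns it into a shift of the dual Gaussian indexed by \<open>l\<close>; the Gaussian in
  \<open>p\<close> is untouched. The factor \<gamma> / sqrt pi inverts the one in
  \<open>poisson_gaussian\<close>.\<close>

lemma twisted_sum_poisson:
  fixes \<gamma> \<theta> :: real
  assumes \<gamma>: "\<gamma> > 0"
  shows "twisted_sum (pi / \<gamma>) \<theta> = of_real (\<gamma> / sqrt pi *
    (\<Sum>\<^sub>\<infinity>(p::int, l::int)\<in>UNIV. exp (- ((pi / \<gamma>)\<^sup>2 * (of_int p)\<^sup>2)) * exp (- (\<gamma> * (- (\<theta> / pi * of_int p)) + \<gamma> * of_int l)\<^sup>2)))"
proof -
  let ?e = "\<lambda>p::int. exp (- ((pi / \<gamma>)\<^sup>2 * (of_int p)\<^sup>2))"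
  let ?s = "\<lambda>p::int. - (\<theta> / pi * of_int p)"
  define R where "R p = (\<Sum>\<^sub>\<infinity>l::int. exp (- (\<gamma> * ?s p + \<gamma> * of_int l)\<^sup>2))" for p :: int
  have h: "pi / \<gamma> > 0" using \<gamma> by simp
  have e: "?e summable_on UNIV" by (rule summable_on_gaussian_int) (use \<gamma> in auto)
  have R: "((\<lambda>l::int. exp (- (\<gamma> * ?s p + \<gamma> * of_int l)\<^sup>2)) has_sum R p) UNIV" for p
    unfolding R_def by (intro has_sum_infsum gaussian_translates \<gamma>)
  have R0: "R p \<ge> 0" for p
    unfolding R_def by (rule infsum_nonneg) simp
  have RB: "R p \<le> gauss_bound \<gamma>" for p
    unfolding R_def by (rule gaussian_translates[OF \<gamma>])
  have f: "((\<lambda>q::int. of_real (?e q) * cis (- 2 * \<theta> * of_int p * of_int q)) has_sum of_real (\<gamma> / sqrt pi * R p)) UNIV" for p :: int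
  proof -
    have c: "cis (2 * pi * of_int q * ?s p) = cis (- 2 * \<theta> * of_int p * of_int q)" for q :: int
      by (rule arg_cong[where f = cis]) simp
    have "(\<lambda>q::int. norm (of_real (?e q) * cis (- 2 * \<theta> * of_int p * of_int q))) summable_on UNIV"
      using e by (simp add: norm_mult)
    then have "((\<lambda>q::int. of_real (?e q) * cis (- 2 * \<theta> * of_int p * of_int q)) has_sum
       (\<Sum>\<^sub>\<infinity>q::int. of_real (?e q) * cis (- 2 * \<theta> * of_int p * of_int q))) UNIV"
      by (rule has_sum_infsum[OF abs_summable_summable])
    also have "(\<Sum>\<^sub>\<infinity>q::int. of_real (?e q) * cis (- 2 * \<theta> * of_int p * of_int q)) = of_real (\<gamma> / sqrt pi * R p)"
      using poisson_gaussian[OF \<gamma>, of "?s p"] \<gamma> unfolding c R_def[symmetric] by (simp add: field_simps)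
    finally show ?thesis .
  qed
  \<comment> \<open>The sum over pairs needs joint summability; it holds because the row sums
    \<open>R p\<close> are bounded uniformly in \<open>p\<close>.\<close>
  have summ: "(\<lambda>(p::int, l::int). ?e p * exp (- (\<gamma> * ?s p + \<gamma> * of_int l)\<^sup>2)) summable_on UNIV \<times> UNIV"
  proof (rule summable_on_SigmaI)
    show "((\<lambda>l. (\<lambda>(p::int, l::int). ?e p * exp (- (\<gamma> * ?s p + \<gamma> * of_int l)\<^sup>2)) (p, l)) has_sum ?e p * R p) UNIV" for p
      unfolding prod.case by (rule has_sum_cmult_right[OF R])
    show "(\<lambda>p. ?e p * R p) summable_on UNIV"
      by (rule summable_on_comparison_test[OF summable_on_cmult_left[OF e, of "gauss_bound \<gamma>"]])
         (use R0 RB in \<open>auto intro: mult_left_mono\<close>)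
  qed auto
  then have "((\<lambda>(p::int, l::int). ?e p * exp (- (\<gamma> * ?s p + \<gamma> * of_int l)\<^sup>2)) has_sum
      (\<Sum>\<^sub>\<infinity>(p::int, l::int)\<in>UNIV. ?e p * exp (- (\<gamma> * ?s p + \<gamma> * of_int l)\<^sup>2))) (Sigma UNIV (\<lambda>_. UNIV))"
    using has_sum_infsum by (simp only: UNIV_Times_UNIV)
  then have "((\<lambda>p. ?e p * R p) has_sum (\<Sum>\<^sub>\<infinity>(p::int, l::int)\<in>UNIV. ?e p * exp (- (\<gamma> * ?s p + \<gamma> * of_int l)\<^sup>2))) UNIV"
    by (rule has_sum_SigmaD) (simp only: prod.case has_sum_cmult_right[OF R])
  from has_sum_of_real[OF has_sum_cmult_right[OF this, of "\<gamma> / sqrt pi"], where 'a = complex]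
  have "((\<lambda>p. of_real (?e p) * of_real (\<gamma> / sqrt pi * R p)) has_sum
     (of_real (\<gamma> / sqrt pi * (\<Sum>\<^sub>\<infinity>(p::int, l::int)\<in>UNIV. ?e p * exp (- (\<gamma> * ?s p + \<gamma> * of_int l)\<^sup>2))) :: complex)) UNIV"
    by (simp add: mult_ac)
  moreover note has_sum_twisted_sum[OF h f]
  ultimately show ?thesis
    by (rule has_sum_unique[symmetric])
qed

section \<open>The rectangular and hexagonal lattices: no twist, and a twist by signs\<close>

lemma twisted_sum_0:
  assumes h: "h > 0"
  shows "twisted_sum h 0 = of_real ((\<Sum>\<^sub>\<infinity>q::int. exp (- (h\<^sup>2 * (of_int q)\<^sup>2)))\<^sup>2)"
proof -
  let ?S = "\<Sum>\<^sub>\<infinity>q::int. exp (- (h\<^sup>2 * (of_int q)\<^sup>2))"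
  have e: "((\<lambda>q::int. of_real (exp (- (h\<^sup>2 * (of_int q)\<^sup>2)))) has_sum (of_real ?S :: complex)) UNIV"
    by (intro has_sum_of_real has_sum_infsum summable_on_gaussian_int) (use h in auto)
  then have "((\<lambda>p::int. of_real (exp (- (h\<^sup>2 * (of_int p)\<^sup>2))) * of_real ?S) has_sum twisted_sum h 0) UNIV"
    by (intro has_sum_twisted_sum h) simp
  moreover have "((\<lambda>p::int. of_real (exp (- (h\<^sup>2 * (of_int p)\<^sup>2))) * of_real ?S) has_sum (of_real ?S * of_real ?S :: complex)) UNIV"
    by (rule has_sum_cmult_left[OF e])
  ultimately show ?thesis
    by (simp add: has_sum_unique power2_eq_square)
qed

lemma has_sum_int_parity:
  fixes g :: "int \<Rightarrow> 'b::{topological_comm_monoid_add,t2_space}"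
  assumes "((\<lambda>j. g (2 * j)) has_sum a) UNIV" "((\<lambda>j. g (2 * j + 1)) has_sum b) UNIV"
  shows "(g has_sum a + b) UNIV"
proof -
  have "bij_betw (\<lambda>j::int. 2 * j) UNIV {n. even n}"
    by (rule bij_betw_byWitness[of _ "\<lambda>n. n div 2"]) auto
  from has_sum_reindex_bij_betw[OF this, of g a] assms(1) have "(g has_sum a) {n. even n}" by simp
  moreover have "bij_betw (\<lambda>j::int. 2 * j + 1) UNIV {n. odd n}"
    by (rule bij_betw_byWitness[of _ "\<lambda>n. n div 2"]) auto
  from has_sum_reindex_bij_betw[OF this, of g b] assms(2) have "(g has_sum b) {n. odd n}" by simp
  ultimately have "(g has_sum a + b) ({n. even n} \<union> {n. odd n})"
    by (rule has_sum_Un_disjoint) auto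
  then show ?thesis by (simp add: Collect_disj_eq[symmetric])
qed

text \<open>The twist is the sign (-1)^(p q), negative only when p and q are both odd. Rows with
  even p sum to I + J, rows with odd p to I - J, which gives I (I + J) + J (I - J).\<close>

lemma twisted_sum_half_pi:
  assumes h: "h > 0"
  defines "I \<equiv> (\<Sum>\<^sub>\<infinity>j::int. exp (- (h\<^sup>2 * (of_int (2 * j))\<^sup>2)))"
    and "J \<equiv> (\<Sum>\<^sub>\<infinity>j::int. exp (- (h\<^sup>2 * (of_int (2 * j + 1))\<^sup>2)))"
  shows "twisted_sum h (- pi / 2) = of_real (I\<^sup>2 + 2 * I * J - J\<^sup>2)"
proof -
  let ?e = "\<lambda>q::int. complex_of_real (exp (- (h\<^sup>2 * (of_int q)\<^sup>2)))"
  have s: "(\<lambda>n::int. exp (- (h\<^sup>2 * (of_int n)\<^sup>2))) summable_on UNIV"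
    by (rule summable_on_gaussian_int) (use h in auto)
  have "(\<lambda>j::int. exp (- (h\<^sup>2 * (of_int (2 * j))\<^sup>2))) summable_on UNIV"
    using summable_on_reindex[of "\<lambda>j::int. 2 * j" UNIV "\<lambda>n. exp (- (h\<^sup>2 * (of_int n)\<^sup>2))"]
      summable_on_subset[OF s, of "range (\<lambda>j::int. 2 * j)"] by (simp add: o_def inj_on_def)
  then have I: "((\<lambda>j. ?e (2 * j)) has_sum of_real I) UNIV"
    unfolding I_def by (intro has_sum_of_real has_sum_infsum)
  have "(\<lambda>j::int. exp (- (h\<^sup>2 * (of_int (2 * j + 1))\<^sup>2))) summable_on UNIV"
    using summable_on_reindex[of "\<lambda>j::int. 2 * j + 1" UNIV "\<lambda>n. exp (- (h\<^sup>2 * (of_int n)\<^sup>2))"]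
      summable_on_subset[OF s, of "range (\<lambda>j::int. 2 * j + 1)"] by (simp add: o_def inj_on_def)
  then have J: "((\<lambda>j. ?e (2 * j + 1)) has_sum of_real J) UNIV"
    unfolding J_def by (intro has_sum_of_real has_sum_infsum)
  define f where "f p = (if even p then of_real (I + J) else of_real (I - J) :: complex)" for p :: int
  have cis_even: "cis (pi * of_int (2 * n)) = 1" for n
    by (simp flip: mult.assoc add: mult.commute[of pi])
  have cis_int: "cis (pi * of_int n) = (if even n then 1 else - 1)" for n :: int
  proof (cases "even n")
    case True
    then obtain m where "n = 2 * m" by blast
    then show ?thesis using cis_even[of m] by simp
  next
    case False
    then obtain m where n: "n = 2 * m + 1" by (elim oddE)
    have "pi * of_int n = pi * of_int (2 * m) + pi"
      by (simp add: n distrib_left)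
    then have "cis (pi * of_int n) = cis (pi * of_int (2 * m)) * cis pi"
      by (simp only: cis_mult)
    then show ?thesis using False cis_even[of m] by simp
  qed
  have cis: "cis (- 2 * (- pi / 2) * of_int p * of_int q) = (if even p \<or> even q then 1 else - 1)" for p q :: int
    using cis_int[of "p * q"] by (simp add: mult.assoc)
  have "((\<lambda>q::int. ?e q * cis (- 2 * (- pi / 2) * of_int p * of_int q)) has_sum f p) UNIV" for p
  proof (cases "even p")
    case True
    then show ?thesis
      unfolding cis using has_sum_int_parity[of ?e, OF I J] by (simp add: f_def)
  next
    case False
    have "((\<lambda>q::int. ?e q * (if even q then 1 else - 1)) has_sum of_real I + - of_real J) UNIV"
      by (rule has_sum_int_parity) (use I has_sum_uminusI[OF J] in auto)
    then show ?thesis unfolding cis using False by (simp add: f_def)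
  qed
  then have "((\<lambda>p. ?e p * f p) has_sum twisted_sum h (- pi / 2)) UNIV"
    by (rule has_sum_twisted_sum[OF h])
  moreover have "((\<lambda>p. ?e p * f p) has_sum of_real I * of_real (I + J) + of_real J * of_real (I - J)) UNIV"
    by (rule has_sum_int_parity)
       (use has_sum_cmult_left[OF I, of "of_real (I + J)"] has_sum_cmult_left[OF J, of "of_real (I - J)"] in \<open>simp_all add: f_def\<close>)
  ultimately have "twisted_sum h (- pi / 2) = of_real I * of_real (I + J) + of_real J * of_real (I - J)"
    by (rule has_sum_unique)
  then show ?thesis by (simp add: power2_eq_square algebra_simps)
qed

section \<open>Stationary solutions\<close>

lemma set_integral_lebesgue_eq_lborel:
  fixes f :: "complex \<Rightarrow> real"
  assumes "K \<in> sets borel" "f \<in> borel_measurable borel"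
  shows "(LINT z:K|lebesgue. f z) = (\<integral>z. indicator K z *\<^sub>R f z \<partial>lborel)"
  unfolding set_lebesgue_integral_def by (rule integral_completion) (use assms in simp)

context gaussian_theta
begin

lemma fundamental_cell_borel: "fundamental_cell \<tau> \<gamma> \<in> sets borel"
  using compact_fundamental_cell by (intro borel_closed compact_imp_closed)

lemma cell_integral_norm_power2:
  assumes \<tau>: "Im \<tau> > 0" "pi / h * Im \<tau> = h * real N"
  shows "(LINT z:fundamental_cell \<tau> (pi / h)|lebesgue. cmod (c * u z) ^ 2)
    = (cmod c)\<^sup>2 * (pi / h * (real N * sqrt (pi / 2)))"
proof -
  let ?K = "fundamental_cell \<tau> (pi / h)"
  have "(LINT z:?K|lebesgue. cmod (c * u z) ^ 2) = (\<integral>z. indicator ?K z *\<^sub>R cmod (c * u z) ^ 2 \<partial>lborel)"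
    by (rule set_integral_lebesgue_eq_lborel[OF fundamental_cell_borel]) measurable
  also have "complex_of_real \<dots> = (\<integral>z. complex_of_real (indicator ?K z *\<^sub>R cmod (c * u z) ^ 2) \<partial>lborel)"
    by (rule integral_complex_of_real[symmetric])
  also have "\<dots> = (\<integral>z. of_real ((cmod c)\<^sup>2) * (indicator ?K z *\<^sub>R (u z * cnj (u z))) \<partial>lborel)"
    unfolding complex_norm_square[symmetric]
    by (simp add: norm_mult power_mult_distrib scaleR_conv_of_real mult_ac)
  also have "\<dots> = of_real ((cmod c)\<^sup>2 * (pi / h * (real N * sqrt (pi / 2))))"
    unfolding integral_mult_right_zero integral_cell_sq[OF \<tau>] by simp
  finally show ?thesis by (simp only: of_real_eq_iff)
qed

lemma cell_integral_norm_power4: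
  assumes \<tau>: "Im \<tau> > 0" "pi / h * Im \<tau> = h * real N"
  shows "complex_of_real (LINT z:fundamental_cell \<tau> (pi / h)|lebesgue. cmod (c * u z) ^ 4)
    = of_real ((cmod c) ^ 4 * (pi / h * (real N * (sqrt pi / 2)))) * twisted_sum h \<theta>"
proof -
  let ?K = "fundamental_cell \<tau> (pi / h)"
  have u4: "complex_of_real (cmod (u z) ^ 4) = u z * cnj (u z) * u z * cnj (u z)" for z
  proof -
    have "complex_of_real (cmod (u z) ^ 4) = of_real ((cmod (u z))\<^sup>2) * of_real ((cmod (u z))\<^sup>2)"
      by (simp add: power2_eq_square power4_eq_xxxx)
    then show ?thesis by (simp only: complex_norm_square mult.assoc)
  qed
  have "(LINT z:?K|lebesgue. cmod (c * u z) ^ 4) = (\<integral>z. indicator ?K z *\<^sub>R cmod (c * u z) ^ 4 \<partial>lborel)"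
    by (rule set_integral_lebesgue_eq_lborel[OF fundamental_cell_borel]) measurable
  also have "complex_of_real \<dots> = (\<integral>z. complex_of_real (indicator ?K z *\<^sub>R cmod (c * u z) ^ 4) \<partial>lborel)"
    by (rule integral_complex_of_real[symmetric])
  also have "\<dots> = (\<integral>z. of_real ((cmod c) ^ 4) * (indicator ?K z *\<^sub>R (u z * cnj (u z) * u z * cnj (u z))) \<partial>lborel)"
    unfolding u4[symmetric]
    by (simp add: norm_mult power_mult_distrib scaleR_conv_of_real mult_ac)
  also have "\<dots> = of_real ((cmod c) ^ 4 * (pi / h * (real N * (sqrt pi / 2)))) * twisted_sum h \<theta>"
    unfolding integral_mult_right_zero integral_cell_quartic[OF \<tau>] by simp
  finally show ?thesis .
qed

text \<open>The width pi / h and the multiplicity N cancel. The Gaussian constants sqrt pi / 2 and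
  sqrt (pi / 2) have quotient 1 / sqrt 2, the constant that the projector produced as well.\<close>

lemma cell_ratio:
  assumes \<tau>: "Im \<tau> > 0" "pi / h * Im \<tau> = h * real N" and N: "N \<ge> 1" and c: "c \<noteq> 0"
  shows "complex_of_real ((LINT z:fundamental_cell \<tau> (pi / h)|lebesgue. cmod (c * u z) ^ 4) /
            (LINT z:fundamental_cell \<tau> (pi / h)|lebesgue. cmod (c * u z) ^ 2))
    = of_real ((cmod c)\<^sup>2) * (twisted_sum h \<theta> / of_real (sqrt 2))"
proof -
  let ?x = "(cmod c) ^ 4 * (pi / h * (real N * (sqrt pi / 2)))" and ?y = "(cmod c)\<^sup>2 * (pi / h * (real N * sqrt (pi / 2)))"
  have ratio: "?x / ?y = (cmod c)\<^sup>2 / sqrt 2"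
  proof -
    have "sqrt pi / 2 = sqrt (pi / 2) / sqrt 2"
      by (simp add: real_sqrt_divide)
    moreover have "cmod c > 0" "sqrt (pi / 2) > 0" "sqrt 2 > (0::real)" "real N > 0"
      using c N by auto
    ultimately show ?thesis
      using h by (simp add: field_simps power2_eq_square power4_eq_xxxx)
  qed
  have "of_real ?x * twisted_sum h \<theta> / of_real ?y = of_real (?x / ?y) * twisted_sum h \<theta>"
    by (simp only: of_real_divide times_divide_eq_left)
  also have "\<dots> = of_real ((cmod c)\<^sup>2) * (twisted_sum h \<theta> / of_real (sqrt 2))"
    unfolding ratio by simp
  finally show ?thesis
    unfolding of_real_divide cell_integral_norm_power4[OF \<tau>] cell_integral_norm_power2[OF \<tau>] .
qed

lemma LLL_proj_cubic_multiple:
  "LLL_proj (\<lambda>w. of_real ((cmod (a * u w))\<^sup>2) * (a * u w)) z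
     = of_real ((cmod a)\<^sup>2) * (twisted_sum h \<theta> / of_real (sqrt 2)) * (a * u z)"
proof -
  have "LLL_proj (\<lambda>w. (of_real ((cmod a)\<^sup>2) * a) * (of_real ((cmod (u w))\<^sup>2) * u w)) z
      = (of_real ((cmod a)\<^sup>2) * a) * LLL_proj (\<lambda>w. of_real ((cmod (u w))\<^sup>2) * u w) z"
    unfolding LLL_proj_def mult.left_commute[of _ "of_real ((cmod a)\<^sup>2) * a"] integral_mult_right_zero ..
  moreover have "(\<lambda>w. of_real ((cmod (a * u w))\<^sup>2) * (a * u w)) = (\<lambda>w. (of_real ((cmod a)\<^sup>2) * a) * (of_real ((cmod (u w))\<^sup>2) * u w))"
    by (simp add: fun_eq_iff norm_mult power_mult_distrib)
  ultimately show ?thesis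
    by (simp only: LLL_proj_theta) simp
qed

lemma poly_growth_multiple: "poly_growth (\<lambda>z. a * u z)"
  unfolding poly_growth_def
proof (intro conjI exI allI)
  show "(\<lambda>z. a * u z) \<in> borel_measurable lebesgue"
    by (rule measurable_completion) simp
  \<comment> \<open>The theta sum is bounded by \<open>B\<close>, so the growth exponent 0
    suffices.\<close>
  show "cmod (a * u z) \<le> (cmod a * B) * (1 + cmod z) ^ 0" for z
    using norm_theta_sum_le[of z] by (simp add: norm_mult mult_left_mono)
qed

text \<open>The time factor is unimodular, so it leaves the modulus in the nonlinearity unchanged.
  By homogeneity the equation reduces at each \<open>z\<close> to \<i> e' = lam |\<kappa>|^2
  e.\<close>

lemma stationary_solution_multiple:
  assumes lam: "complex_of_real lam = of_real ((cmod c)\<^sup>2) * (twisted_sum h \<theta> / of_real (sqrt 2))"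
  shows "stationary_solution (\<lambda>t z. \<kappa> * exp (- \<i> * of_real (lam * (cmod \<kappa>)\<^sup>2 * t)) * (c * u z))"
proof -
  define e where "e t = exp (- \<i> * of_real (lam * (cmod \<kappa>)\<^sup>2 * t))" for t
  have norm_e: "cmod (e t) = 1" for t by (simp add: e_def)
  have eq: "(\<lambda>z. \<kappa> * e t * (c * u z)) = (\<lambda>z. (\<kappa> * e t * c) * u z)" for t by (simp add: mult.assoc)
  have e': "(e has_vector_derivative (- \<i> * of_real (lam * (cmod \<kappa>)\<^sup>2)) * e t) (at t)" for t
  proof -
    have "((\<lambda>z. exp (- \<i> * of_real (lam * (cmod \<kappa>)\<^sup>2) * z)) has_field_derivative
        (- \<i> * of_real (lam * (cmod \<kappa>)\<^sup>2)) * exp (- \<i> * of_real (lam * (cmod \<kappa>)\<^sup>2) * of_real t)) (at (of_real t))"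
      by (auto intro!: derivative_eq_intros)
    from has_vector_derivative_real_field[OF this] show ?thesis
      by (simp add: e_def[abs_def] mult.assoc)
  qed
  have "LLL_solution (\<lambda>t z. \<kappa> * e t * (c * u z))"
    unfolding LLL_solution_def
  proof (intro conjI allI)
    show "poly_growth (\<lambda>z. \<kappa> * e t * (c * u z))" for t
      unfolding eq by (rule poly_growth_multiple)
    fix t :: real and z
    let ?D = "\<kappa> * ((- \<i> * of_real (lam * (cmod \<kappa>)\<^sup>2)) * e t) * (c * u z)"
    have "((\<lambda>s. \<kappa> * e s * (c * u z)) has_vector_derivative ?D) (at t)"
      by (intro has_vector_derivative_mult_left has_vector_derivative_mult_right e')
    moreover have "\<i> * ?D = LLL_proj (\<lambda>w. of_real ((cmod (\<kappa> * e t * (c * u w)))\<^sup>2) * (\<kappa> * e t * (c * u w))) z"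
    proof -
      have "LLL_proj (\<lambda>w. of_real ((cmod (\<kappa> * e t * (c * u w)))\<^sup>2) * (\<kappa> * e t * (c * u w))) z
          = of_real ((cmod (\<kappa> * e t * c))\<^sup>2) * (twisted_sum h \<theta> / of_real (sqrt 2)) * ((\<kappa> * e t * c) * u z)"
        using LLL_proj_cubic_multiple[of "\<kappa> * e t * c" z] by (simp only: mult.assoc)
      also have "(cmod (\<kappa> * e t * c))\<^sup>2 = (cmod \<kappa>)\<^sup>2 * (cmod c)\<^sup>2"
        by (simp add: norm_mult norm_e power_mult_distrib)
      also have "of_real ((cmod \<kappa>)\<^sup>2 * (cmod c)\<^sup>2) * (twisted_sum h \<theta> / of_real (sqrt 2)) = of_real ((cmod \<kappa>)\<^sup>2) * complex_of_real lam"
        unfolding lam of_real_mult by (simp only: mult.assoc)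
      finally show ?thesis by (simp add: mult_ac)
    qed
    ultimately show "\<exists>D. ((\<lambda>s. \<kappa> * e s * (c * u z)) has_vector_derivative D) (at t) \<and>
        \<i> * D = LLL_proj (\<lambda>w. of_real ((cmod (\<kappa> * e t * (c * u w)))\<^sup>2) * (\<kappa> * e t * (c * u w))) z"
      by blast
  qed
  moreover have "\<kappa> * e t * (c * u z) = exp (- \<i> * of_real ((lam * (cmod \<kappa>)\<^sup>2) * t)) * (\<kappa> * (c * u z))" for t z
    by (simp add: e_def)
  ultimately show ?thesis
    unfolding stationary_solution_def e_def
    by (intro conjI allI exI[of _ "lam * (cmod \<kappa>)\<^sup>2"] exI[of _ "\<lambda>z. \<kappa> * (c * u z)"])
qed

end

theorem proposition2p8:
  fixes N k :: nat and \<gamma> :: real and \<tau> \<kappa> :: complex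
  assumes "N \<ge> 1" and "\<gamma> > 0" and "\<gamma>\<^sup>2 * Im \<tau> = pi * real N"
    and "k \<le> N - 1"
  shows
    "let K = fundamental_cell \<tau> \<gamma>;
         lam\<^sub>0 = (LINT z:K|lebesgue. cmod (Phi N \<gamma> \<tau> k z) ^ 4) /
              (LINT z:K|lebesgue. cmod (Phi N \<gamma> \<tau> k z) ^ 2)
     in stationary_solution
          (\<lambda>t z. \<kappa> * exp (- \<i> * of_real (lam\<^sub>0 * (cmod \<kappa>)\<^sup>2 * t)) * Phi N \<gamma> \<tau> k z) \<and>
        lam\<^sub>0 = \<gamma> / sqrt (2 * pi) * exp (pi\<^sup>2 / (2 * \<gamma>\<^sup>2)) *
          (\<Sum>\<^sub>\<infinity>(j::int, l::int)\<in>UNIV.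
             exp (- \<gamma>\<^sup>2 * (cmod (of_int j * \<tau> / of_nat N - of_int l))\<^sup>2)) \<and>
        (N = 1 \<and> \<tau> = \<i> * of_real (pi / \<gamma>\<^sup>2) \<longrightarrow>
          lam\<^sub>0 = 1 / sqrt 2 * exp (pi\<^sup>2 / (2 * \<gamma>\<^sup>2)) *
            (\<Sum>\<^sub>\<infinity>q::int. exp (- pi\<^sup>2 * (of_int q)\<^sup>2 / \<gamma>\<^sup>2))\<^sup>2) \<and>
        (N = 1 \<and> \<tau> = exp (2 * \<i> * of_real pi / 3) \<and> \<gamma> = sqrt (2 * pi) / 3 powr (1/4) \<longrightarrow>
          (let I = (\<Sum>\<^sub>\<infinity>j::int. exp (- pi\<^sup>2 * (of_int (2 * j))\<^sup>2 / \<gamma>\<^sup>2));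
               J = (\<Sum>\<^sub>\<infinity>j::int. exp (- pi\<^sup>2 * (of_int (2 * j + 1))\<^sup>2 / \<gamma>\<^sup>2))
           in lam\<^sub>0 = 1 / sqrt 2 * exp (pi\<^sup>2 / (2 * \<gamma>\<^sup>2)) * (I\<^sup>2 + 2 * I * J - J\<^sup>2)))"
proof -
  define h \<theta> \<nu> where "h = pi / \<gamma>" and "\<theta> = pi * Re \<tau> / real N" and "\<nu> = 2 * pi * real k / real N"
  define c where "c = exp (- \<i> * of_real pi * (\<tau> / of_nat N) / 4)"
  have N: "real N > 0" using assms(1) by simp
  have h: "h > 0" using assms(2) by (simp add: h_def)
  interpret gaussian_theta h \<theta> \<nu> by standard (rule h)
  have Phi: "Phi N \<gamma> \<tau> k = (\<lambda>z. c * theta_sum h \<theta> \<nu> z)"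
    using Phi_eq_theta_sum[OF assms(1-3)] by (simp add: fun_eq_iff c_def h_def \<theta>_def \<nu>_def)
  have Im: "Im \<tau> = pi * real N / \<gamma>\<^sup>2" using assms(2,3) by (simp add: field_simps)
  have Im_pos: "Im \<tau> > 0" unfolding Im using assms(2) N by simp
  have \<gamma>h: "\<gamma> = pi / h" by (simp add: h_def)
  have Im_h: "pi / h * Im \<tau> = h * real N"
    unfolding Im h_def using assms(2) by (simp add: power2_eq_square)
  have c0: "c \<noteq> 0" by (simp add: c_def)
  \<comment> \<open>Only the imaginary part pi / \<gamma>^2 of \<tau> / N contributes to the
    modulus.\<close>
  have c2: "(cmod c)\<^sup>2 = exp (pi\<^sup>2 / (2 * \<gamma>\<^sup>2))"
  proof -
    have "cmod c = exp (pi\<^sup>2 / (4 * \<gamma>\<^sup>2))"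
      using N by (simp add: c_def Im power2_eq_square)
    then show ?thesis by (simp add: exp_double[symmetric] field_simps)
  qed
  define lam where "lam = (LINT z:fundamental_cell \<tau> \<gamma>|lebesgue. cmod (Phi N \<gamma> \<tau> k z) ^ 4) /
              (LINT z:fundamental_cell \<tau> \<gamma>|lebesgue. cmod (Phi N \<gamma> \<tau> k z) ^ 2)"
  have lam: "complex_of_real lam = of_real ((cmod c)\<^sup>2) * (twisted_sum h \<theta> / of_real (sqrt 2))"
    using cell_ratio[OF Im_pos Im_h assms(1) c0] unfolding lam_def Phi \<gamma>h[symmetric] .
  have lam_eq: "lam = 1 / sqrt 2 * exp (pi\<^sup>2 / (2 * \<gamma>\<^sup>2)) * S" if "twisted_sum h \<theta> = of_real S" for S
  proof -
    have "complex_of_real lam = of_real (1 / sqrt 2 * exp (pi\<^sup>2 / (2 * \<gamma>\<^sup>2)) * S)"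
      unfolding lam that c2 by simp
    then show ?thesis by (simp only: of_real_eq_iff)
  qed
  have h2: "- (h\<^sup>2 * x) = - pi\<^sup>2 * x / \<gamma>\<^sup>2" for x
    by (simp add: h_def power_divide)
  have stationary: "stationary_solution (\<lambda>t z. \<kappa> * exp (- \<i> * of_real (lam * (cmod \<kappa>)\<^sup>2 * t)) * Phi N \<gamma> \<tau> k z)"
    unfolding Phi by (rule stationary_solution_multiple[OF lam])
  have general: "lam = \<gamma> / sqrt (2 * pi) * exp (pi\<^sup>2 / (2 * \<gamma>\<^sup>2)) *
          (\<Sum>\<^sub>\<infinity>(j::int, l::int)\<in>UNIV. exp (- \<gamma>\<^sup>2 * (cmod (of_int j * \<tau> / of_nat N - of_int l))\<^sup>2))"
  proof -
    \<comment> \<open>In \<gamma>^2 |j \<tau> / N - l|^2 the imaginary part contributes (pi /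
      \<gamma>)^2 j^2, the Gaussian left alone by Poisson summation; the real part contributes the
      shifted dual Gaussian.\<close>
    have "exp (- ((pi / \<gamma>)\<^sup>2 * (of_int j)\<^sup>2)) * exp (- (\<gamma> * (- (\<theta> / pi * of_int j)) + \<gamma> * of_int l)\<^sup>2)
        = exp (- \<gamma>\<^sup>2 * (cmod (of_int j * \<tau> / of_nat N - of_int l))\<^sup>2)" for j l :: int
    proof -
      have "(cmod (of_int j * \<tau> / of_nat N - of_int l))\<^sup>2 = (of_int j * Re \<tau> / real N - of_int l)\<^sup>2 + (of_int j * Im \<tau> / real N)\<^sup>2"
        unfolding cmod_power2 by simp
      also have "of_int j * Im \<tau> / real N = of_int j * (pi / \<gamma>\<^sup>2)"
        unfolding Im using N by simp
      finally have "- \<gamma>\<^sup>2 * (cmod (of_int j * \<tau> / of_nat N - of_int l))\<^sup>2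
          = - (\<gamma>\<^sup>2 * (of_int j * (pi / \<gamma>\<^sup>2))\<^sup>2) + - (\<gamma> * (of_int j * Re \<tau> / real N - of_int l))\<^sup>2"
        by (simp add: power_mult_distrib distrib_left)
      also have "\<gamma>\<^sup>2 * (of_int j * (pi / \<gamma>\<^sup>2))\<^sup>2 = (pi / \<gamma>)\<^sup>2 * (of_int j)\<^sup>2"
        using assms(2) by (simp add: field_simps power2_eq_square)
      also have "(\<gamma> * (of_int j * Re \<tau> / real N - of_int l))\<^sup>2 = (\<gamma> * (- (\<theta> / pi * of_int j)) + \<gamma> * of_int l)\<^sup>2"
        unfolding power2_eq_iff by (rule disjI2) (simp add: \<theta>_def algebra_simps)
      finally show ?thesis by (simp only: exp_add)
    qed
    then have "twisted_sum h \<theta> = of_real (\<gamma> / sqrt pi * (\<Sum>\<^sub>\<infinity>(j::int, l::int)\<in>UNIV. exp (- \<gamma>\<^sup>2 * (cmod (of_int j * \<tau> / of_nat N - of_int l))\<^sup>2)))"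
      unfolding h_def using twisted_sum_poisson[OF assms(2), of \<theta>] by simp
    from lam_eq[OF this] show ?thesis
      by (simp add: real_sqrt_mult)
  qed
  have rectangular: "lam = 1 / sqrt 2 * exp (pi\<^sup>2 / (2 * \<gamma>\<^sup>2)) *
            (\<Sum>\<^sub>\<infinity>q::int. exp (- pi\<^sup>2 * (of_int q)\<^sup>2 / \<gamma>\<^sup>2))\<^sup>2" if "\<tau> = \<i> * of_real (pi / \<gamma>\<^sup>2)"
  proof -
    have "\<theta> = 0" using that by (simp add: \<theta>_def)
    then show ?thesis using lam_eq twisted_sum_0[OF h] unfolding h2 by simp
  qed
  have hexagonal: "lam = 1 / sqrt 2 * exp (pi\<^sup>2 / (2 * \<gamma>\<^sup>2)) * (I\<^sup>2 + 2 * I * J - J\<^sup>2)"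
    if "N = 1" "\<tau> = exp (2 * \<i> * of_real pi / 3)"
      and "I = (\<Sum>\<^sub>\<infinity>j::int. exp (- pi\<^sup>2 * (of_int (2 * j))\<^sup>2 / \<gamma>\<^sup>2))"
      and "J = (\<Sum>\<^sub>\<infinity>j::int. exp (- pi\<^sup>2 * (of_int (2 * j + 1))\<^sup>2 / \<gamma>\<^sup>2))" for I J
  proof -
    \<comment> \<open>The real part of exp (2 \<i> pi / 3) is - 1/2, which makes the twist a
      sign.\<close>
    have "\<theta> = - pi / 2"
      using that(1,2) by (simp add: \<theta>_def Re_exp cos_120)
    then show ?thesis
      using lam_eq twisted_sum_half_pi[OF h] that(3,4) unfolding h2 by simp
  qed
  show ?thesis
    unfolding Let_def lam_def[symmetric]
    using stationary general rectangular hexagonal by blast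
qed

end
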